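(* Let $G=(V,E)$ be an undirected graph with $n$ vertices and $m$ edges, and let $T$ be a DFS tree of $G$. There exists a data structure which occupies exactly $m$ words, can be constructed in $O(m+n)$ time, and answers any query $Q(u,(p_s,p_e))$ in $O(\log n)$ time.
   Context: A query $Q(u,(p_s,p_e))$ takes vertices $u,p_s,p_e\in V$ such that $p_s$ and $p_e$ are the endpoints of an ancestor-descendant path in $T$ (a tree path whose endpoints are in ancestor-descendant relation), and $u$ is a descendant in $T$ of the highest vertex (the one closest to the root) of the tree path between $p_s$ and $p_e$ but does not lie on this path. The query returns the edge of $G$ from $u$ to a vertex of the tree path between $p_s$ and $p_e$ that is incident closest to $p_e$ on this path, and returns null if no edge from $u$ to this path exists. *)

theory Defs
  imports Complex_Main
begin

section \<open>Graphs and DFS trees\<close>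

definition ugraph :: "'a set \<Rightarrow> 'a set set \<Rightarrow> bool" where
  "ugraph V E \<longleftrightarrow> finite V \<and> (\<forall>e\<in>E. e \<subseteq> V \<and> card e = 2)"

text \<open>Configurations reachable by a depth-first traversal from \<open>r\<close> with an arbitrary choice of the
  next neighbour: the stack of open vertices (most recent first), the set of visited vertices, and
  the tree built so far as a set of (parent, child) pairs.\<close>

inductive dfs :: "'a set set \<Rightarrow> 'a \<Rightarrow> 'a list \<Rightarrow> 'a set \<Rightarrow> ('a \<times> 'a) set \<Rightarrow> bool"
  for E r where
  start: "dfs E r [r] {r} {}"
| advance: "\<lbrakk>dfs E r (u # st) S T; {u, v} \<in> E; v \<notin> S\<rbrakk>
    \<Longrightarrow> dfs E r (v # u # st) (insert v S) (insert (u, v) T)"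
| retreat: "\<lbrakk>dfs E r (u # st) S T; \<forall>v. {u, v} \<in> E \<longrightarrow> v \<in> S\<rbrakk> \<Longrightarrow> dfs E r st S T"

text \<open>The traversal is complete and has visited all of \<open>V\<close>, so the tree spans the graph.\<close>

definition dfs_tree :: "'a set \<Rightarrow> 'a set set \<Rightarrow> 'a \<Rightarrow> ('a \<times> 'a) set \<Rightarrow> bool" where
  "dfs_tree V E r T \<longleftrightarrow> r \<in> V \<and> dfs E r [] V T"

section \<open>Queries\<close>

text \<open>\<open>xs\<close> lists the vertices of the tree path from \<open>p\<close> to \<open>q\<close>. In all of the following,
  \<open>(a, b) \<in> T\<^sup>*\<close> says that \<open>a\<close> is an ancestor of \<open>b\<close> (possibly \<open>b\<close> itself).\<close>

definition tree_path :: "('a \<times> 'a) set \<Rightarrow> 'a \<Rightarrow> 'a list \<Rightarrow> 'a \<Rightarrow> bool" where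
  "tree_path T p xs q \<longleftrightarrow> xs \<noteq> [] \<and> hd xs = p \<and> last xs = q \<and> distinct xs \<and>
     successively (\<lambda>x y. (x, y) \<in> T \<or> (y, x) \<in> T) xs"

definition depth :: "('a \<times> 'a) set \<Rightarrow> 'a \<Rightarrow> 'a \<Rightarrow> nat" where
  "depth T r x = (LEAST d. (r, x) \<in> T ^^ d)"

definition is_query ::
  "'a set \<Rightarrow> ('a \<times> 'a) set \<Rightarrow> 'a \<Rightarrow> 'a \<Rightarrow> 'a \<Rightarrow> 'a \<Rightarrow> 'a list \<Rightarrow> bool" where
  "is_query V T r u ps pe xs \<longleftrightarrow>
     u \<in> V \<and> ps \<in> V \<and> pe \<in> V \<and>
     ((ps, pe) \<in> T\<^sup>* \<or> (pe, ps) \<in> T\<^sup>*) \<and> tree_path T ps xs pe \<and>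
     (\<exists>h\<in>set xs. (\<forall>x\<in>set xs. depth T r h \<le> depth T r x) \<and> (h, u) \<in> T\<^sup>*) \<and>
     u \<notin> set xs"

text \<open>The path runs from \<open>ps\<close> to \<open>pe\<close>, so the neighbour of \<open>u\<close> closest to \<open>pe\<close> is the first one met
  when the path is read backwards. \<open>None\<close> is the null answer.\<close>

definition query_answer :: "'a set set \<Rightarrow> 'a \<Rightarrow> 'a list \<Rightarrow> 'a set option" where
  "query_answer E u xs = map_option (\<lambda>v. {u, v}) (find (\<lambda>v. {u, v} \<in> E) (rev xs))"

section \<open>A word RAM\<close>

text \<open>Programs use registers and a random-access memory. The machine is parameterised by the number
  \<open>W\<close> of distinct words: a run exists only if every value computed or loaded is less than \<open>W\<close>;
  taking \<open>W\<close> polynomial in the number of vertices gives words of \<open>O(log n)\<close> bits.  Every operation costs one unit of time.\<close>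

record state =
  reg :: "nat \<Rightarrow> nat"
  mem :: "nat \<Rightarrow> nat"

datatype binop = Add | Sub | Mul | Div | Mod | Less | Eq

datatype exp = Const nat | Reg nat | Load exp | Bin binop exp exp

datatype com =
    Skip
  | Assign nat exp
  | Store exp exp
  | Seq com com
  | Cond exp com com
  | While exp com

fun binop_val :: "binop \<Rightarrow> nat \<Rightarrow> nat \<Rightarrow> nat" where
  "binop_val Add x y = x + y"
| "binop_val Sub x y = x - y"
| "binop_val Mul x y = x * y"
| "binop_val Div x y = x div y"
| "binop_val Mod x y = x mod y"
| "binop_val Less x y = (if x < y then 1 else 0)"
| "binop_val Eq x y = (if x = y then 1 else 0)"

fun val :: "state \<Rightarrow> exp \<Rightarrow> nat" where
  "val s (Const n) = n"
| "val s (Reg i) = reg s i"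
| "val s (Load a) = mem s (val s a)"
| "val s (Bin f a b) = binop_val f (val s a) (val s b)"

fun fits :: "nat \<Rightarrow> state \<Rightarrow> exp \<Rightarrow> bool" where
  "fits W s (Const n) \<longleftrightarrow> n < W"
| "fits W s (Reg i) \<longleftrightarrow> reg s i < W"
| "fits W s (Load a) \<longleftrightarrow> fits W s a \<and> mem s (val s a) < W"
| "fits W s (Bin f a b) \<longleftrightarrow> fits W s a \<and> fits W s b \<and> binop_val f (val s a) (val s b) < W"

fun cost :: "exp \<Rightarrow> nat" where
  "cost (Const n) = 1"
| "cost (Reg i) = 1"
| "cost (Load a) = cost a + 1"
| "cost (Bin f a b) = cost a + cost b + 1"

text \<open>\<open>exec W p s t s'\<close>: started in \<open>s\<close>, program \<open>p\<close> halts in \<open>s'\<close> after \<open>t\<close> units of time.\<close>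

inductive exec :: "nat \<Rightarrow> com \<Rightarrow> state \<Rightarrow> nat \<Rightarrow> state \<Rightarrow> bool" for W where
  Skip: "exec W Skip s 1 s"
| Assign: "fits W s a \<Longrightarrow>
    exec W (Assign i a) s (cost a + 1) (s\<lparr>reg := (reg s)(i := val s a)\<rparr>)"
| Store: "\<lbrakk>fits W s a; fits W s b\<rbrakk> \<Longrightarrow>
    exec W (Store a b) s (cost a + cost b + 1) (s\<lparr>mem := (mem s)(val s a := val s b)\<rparr>)"
| Seq: "\<lbrakk>exec W p s t s'; exec W q s' t' s''\<rbrakk> \<Longrightarrow> exec W (Seq p q) s (t + t') s''"
| CondTrue: "\<lbrakk>fits W s b; val s b \<noteq> 0; exec W p s t s'\<rbrakk> \<Longrightarrow>
    exec W (Cond b p q) s (cost b + 1 + t) s'"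
| CondFalse: "\<lbrakk>fits W s b; val s b = 0; exec W q s t s'\<rbrakk> \<Longrightarrow>
    exec W (Cond b p q) s (cost b + 1 + t) s'"
| WhileFalse: "\<lbrakk>fits W s b; val s b = 0\<rbrakk> \<Longrightarrow> exec W (While b p) s (cost b + 1) s"
| WhileTrue: "\<lbrakk>fits W s b; val s b \<noteq> 0; exec W p s t s'; exec W (While b p) s' t' s''\<rbrakk> \<Longrightarrow>
    exec W (While b p) s (cost b + 1 + t + t') s''"

inductive_cases exec_cases:
  "exec W Skip s t s'"
  "exec W (Assign i a) s t s'"
  "exec W (Store a b) s t s'"
  "exec W (Seq p q) s t s'"
  "exec W (Cond b p q) s t s'"
  "exec W (While b p) s t s'"

lemma exec_deterministic: "exec W p s t s' \<Longrightarrow> exec W p s t2 s2 \<Longrightarrow> t2 = t \<and> s2 = s'"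
proof (induction arbitrary: t2 s2 rule: exec.induct)
  case (Seq p s t s' q t' s'')
  from Seq.prems obtain ta sa tb where "exec W p s ta sa" "exec W q sa tb s2" "t2 = ta + tb"
    by (rule exec_cases)
  with Seq.IH show ?case by metis
next
  case (WhileTrue s b p t s' t' s'')
  from WhileTrue.prems WhileTrue.hyps(2) obtain ta sa tb where
    "exec W p s ta sa" "exec W (While b p) sa tb s2" "t2 = cost b + 1 + ta + tb"
    by (auto elim: exec_cases(6))
  with WhileTrue.IH show ?case by metis
next
  case (CondTrue s b p t s' q)
  from CondTrue.prems CondTrue.hyps(2) obtain ta where
    "exec W p s ta s2" "t2 = cost b + 1 + ta"
    by (auto elim: exec_cases(5))
  with CondTrue.IH show ?case by metis
next
  case (CondFalse s b q t s' p)
  from CondFalse.prems CondFalse.hyps(2) obtain ta where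
    "exec W q s ta s2" "t2 = cost b + 1 + ta"
    by (auto elim: exec_cases(5))
  with CondFalse.IH show ?case by metis
next
  case (WhileFalse s b p)
  from WhileFalse.prems WhileFalse.hyps(2) show ?case by (auto elim: exec_cases(6))
qed (auto elim: exec_cases(1-3))

section \<open>Input and output\<close>

definition words :: "nat list \<Rightarrow> nat \<Rightarrow> nat" where
  "words ws i = (if i < length ws then ws ! i else 0)"

definition holds :: "nat list \<Rightarrow> (nat \<Rightarrow> nat) \<Rightarrow> bool" where
  "holds ws f \<longleftrightarrow> (\<forall>i<length ws. f i = ws ! i)"

text \<open>The graph is given as a list of its edges, in any order and with any orientation, and the tree
  as a parent array in which the root is its own parent.\<close>

definition represents ::
  "nat \<Rightarrow> nat set set \<Rightarrow> nat \<Rightarrow> (nat \<times> nat) set \<Rightarrow> (nat \<times> nat) list \<Rightarrow> nat list \<Rightarrow> bool" where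
  "represents n E r T es par \<longleftrightarrow>
     (\<lambda>(a, b). {a, b}) ` set es = E \<and> length es = card E \<and>
     length par = n \<and> par ! r = r \<and> (\<forall>v<n. v \<noteq> r \<longrightarrow> (par ! v, v) \<in> T)"

definition build_input :: "nat \<Rightarrow> (nat \<times> nat) list \<Rightarrow> nat list \<Rightarrow> state" where
  "build_input n es par =
     \<lparr>reg = (\<lambda>_. 0),
      mem = words ([n, length es] @ concat (map (\<lambda>(a, b). [a, b]) es) @ par)\<rparr>"

definition query_input :: "(nat \<Rightarrow> nat) \<Rightarrow> nat \<Rightarrow> nat \<Rightarrow> nat \<Rightarrow> state" where
  "query_input M u ps pe = \<lparr>reg = words [u, ps, pe], mem = M\<rparr>"

definition query_output :: "state \<Rightarrow> nat set option" where
  "query_output s = (if reg s 0 = 0 then None else Some {reg s 1, reg s 2})"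

text \<open>\<open>D\<close> is the entire data structure: \<open>build\<close> leaves it in the first cells of the memory, and a query
  starts from a memory that is arbitrary outside \<open>D\<close>, with only \<open>u\<close>, \<open>ps\<close>, \<open>pe\<close> in the registers.
  A query may use other cells as scratch space but must leave \<open>D\<close> intact for later queries.\<close>

definition builds ::
  "nat \<Rightarrow> com \<Rightarrow> nat \<Rightarrow> (nat \<times> nat) list \<Rightarrow> nat list \<Rightarrow> real \<Rightarrow> nat list \<Rightarrow> bool" where
  "builds W build n es par b D \<longleftrightarrow>
     (\<exists>t s. exec W build (build_input n es par) t s \<and> real t \<le> b \<and> holds D (mem s))"

definition answers ::
  "nat \<Rightarrow> com \<Rightarrow> nat list \<Rightarrow> nat \<Rightarrow> nat \<Rightarrow> nat \<Rightarrow> real \<Rightarrow> nat set option \<Rightarrow> bool" where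
  "answers W query D u ps pe b ans \<longleftrightarrow>
     (\<forall>M. holds D M \<longrightarrow>
       (\<exists>t s. exec W query (query_input M u ps pe) t s \<and> real t \<le> b \<and>
          holds D (mem s) \<and> query_output s = ans))"

end

theory Submission
  imports Defs
begin

text \<open>
  Every edge of \<open>G\<close> joins a vertex to one of its ancestors, so it is charged to its lower end. An
  Euler tour of \<open>T\<close> gives each vertex an entry and an exit time, which decide ancestry in constant
  time, and two bucket passes sort the edges by (entry time of the lower end, decreasing depth of the
  upper end). A neighbour of \<open>u\<close> on a query path is a proper ancestor of \<open>u\<close>, because a path through
  a descendant of \<open>u\<close> would contain \<open>u\<close>. Among the ancestors of \<open>u\<close>, being below the top of the path
  and being above its bottom are both monotone in the depth, so a binary search over the \<open>m\<close> sorted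
  edges finds the neighbour closest to \<open>pe\<close>.

  The tree data must fit into the same \<open>m\<close> words. As \<open>T\<close> spans \<open>G\<close>, \<open>n - 1 \<le> m\<close>, and the \<open>i\<close>-th word
  carries the entry time of vertex \<open>i + 1\<close> along with the \<open>i\<close>-th edge.
\<close>

section \<open>DFS trees\<close>


text \<open>Both programs are fixed before \<open>n\<close> is known, and a query is handed neither
  \<open>n\<close> nor \<open>m\<close>, so the \<open>m\<close> words must describe themselves:
  every word also carries \<open>m\<close> and a radix \<open>b\<close> that can be read off without
  knowing it. Fields are digits to base \<open>b * b\<close> rather than \<open>b\<close>, since
  \<open>m\<close> may be of the order of \<open>n * n\<close> and clock values range up to
  \<open>2 * n\<close>. A query can look up only entry times of vertices; exit times are stored only
  for upper ends of edges. The tests are shaped accordingly. Two ancestors of \<open>u\<close> are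
  comparable, so a single comparison of entry times tells which one is higher, and an exit time is
  consulted only to decide whether an upper end lies above the bottom of the path. For the same
  reason the sorting passes use the entry time of the upper end in place of its depth, and no array
  of depths is built. For \<open>m = 0\<close> there is no word to read, but then
  \<open>n = 1\<close> and no query exists.\<close>

lemma dfs_invariant:
  assumes "dfs E r st S T" and "ugraph V E" and "r \<in> V"
  shows "r \<in> S \<and> finite S \<and> S \<subseteq> V \<and> T \<subseteq> S \<times> S \<and> set st \<subseteq> S \<and> acyclic T \<and> card T + 1 = card S \<and>
    (\<forall>v\<in>S. (r, v) \<in> T\<^sup>*) \<and> (\<forall>a. (a, r) \<notin> T) \<and> (\<forall>a b c. (a, c) \<in> T \<longrightarrow> (b, c) \<in> T \<longrightarrow> a = b) \<and>
    (\<forall>a b. (a, b) \<in> T \<longrightarrow> {a, b} \<in> E) \<and>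
    sorted_wrt (\<lambda>x y. (y, x) \<in> T\<^sup>*) st \<and>
    (\<forall>x\<in>S - set st. \<forall>y. {x, y} \<in> E \<longrightarrow> y \<in> S) \<and>
    (\<forall>a\<in>S. \<forall>b\<in>S. {a, b} \<in> E \<longrightarrow> (a, b) \<in> T\<^sup>* \<or> (b, a) \<in> T\<^sup>*)"
  using assms
proof (induction rule: dfs.induct)
  case start
  then show ?case by (auto simp: acyclic_def)
next
  case (advance u st S T v)
  from advance.IH[OF advance.prems] have IH: "r \<in> S" "finite S" "S \<subseteq> V" "T \<subseteq> S \<times> S" "u \<in> S" "set st \<subseteq> S" "acyclic T" "card T + 1 = card S"
    "\<forall>v\<in>S. (r, v) \<in> T\<^sup>*" "\<forall>a. (a, r) \<notin> T" "\<forall>a b c. (a, c) \<in> T \<longrightarrow> (b, c) \<in> T \<longrightarrow> a = b"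
    "\<forall>a b. (a, b) \<in> T \<longrightarrow> {a, b} \<in> E"
    "sorted_wrt (\<lambda>x y. (y, x) \<in> T\<^sup>*) (u # st)"
    "\<forall>x\<in>S - set (u # st). \<forall>y. {x, y} \<in> E \<longrightarrow> y \<in> S"
    "\<forall>a\<in>S. \<forall>b\<in>S. {a, b} \<in> E \<longrightarrow> (a, b) \<in> T\<^sup>* \<or> (b, a) \<in> T\<^sup>*"
    by simp_all
  let ?T = "insert (u, v) T"
  have vV: "v \<in> V" using advance.hyps(2) \<open>ugraph V E\<close> by (auto simp: ugraph_def)
  have mono: "T\<^sup>* \<subseteq> ?T\<^sup>*" by (rule rtrancl_mono) auto
  have novu: "(v, u) \<notin> T\<^sup>*"
  proof
    assume "(v, u) \<in> T\<^sup>*"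
    then show False
      using IH(4,5) advance.hyps(3) by (metis converse_rtranclE mem_Sigma_iff subsetD)
  qed
  have uv: "(u, v) \<in> ?T\<^sup>*" by auto
  have anc: "(x, v) \<in> ?T\<^sup>*" if "x \<in> set (u # st)" for x
  proof -
    have "(x, u) \<in> T\<^sup>*" using that IH(13) by auto
    then show ?thesis using mono uv by (meson rtrancl_trans subsetD)
  qed
  have novv: "{v, v} \<notin> E" using \<open>ugraph V E\<close> by (auto simp: ugraph_def)
  \<comment> \<open>A finished vertex has only visited neighbours, so every visited neighbour of the
    new vertex \<open>v\<close> is still on the stack and thus becomes an ancestor of
    \<open>v\<close>. This is where cross edges are excluded.\<close>
  have vnb: "x \<in> set (u # st)" if "x \<in> S" "{x, v} \<in> E" for x
    using IH(14) that advance.hyps(3) by blast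
  have "finite T" using IH(2,4) by (meson finite_SigmaI finite_subset)
  moreover have "(u, v) \<notin> T" using IH(4) advance.hyps(3) by auto
  ultimately have card: "card ?T + 1 = card (insert v S)" using IH(2,8) advance.hyps(3) by simp
  have sorted: "sorted_wrt (\<lambda>x y. (y, x) \<in> ?T\<^sup>*) (v # u # st)"
    using anc sorted_wrt_mono_rel[OF _ IH(13), of "\<lambda>x y. (y, x) \<in> ?T\<^sup>*"] mono by auto
  have reach: "\<forall>x\<in>insert v S. (r, x) \<in> ?T\<^sup>*"
    using IH(5,9) mono uv by (metis insert_iff rtrancl_trans subsetD)
  have comp: "\<forall>a\<in>insert v S. \<forall>b\<in>insert v S. {a, b} \<in> E \<longrightarrow> (a, b) \<in> ?T\<^sup>* \<or> (b, a) \<in> ?T\<^sup>*"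
  proof (intro ballI impI)
    fix a b assume ab: "a \<in> insert v S" "b \<in> insert v S" "{a, b} \<in> E"
    consider "a = v" "b = v" | "a = v" "b \<in> S" | "a \<in> S" "b = v" | "a \<in> S" "b \<in> S"
      using ab by auto
    then show "(a, b) \<in> ?T\<^sup>* \<or> (b, a) \<in> ?T\<^sup>*"
    proof cases
      case 2 then show ?thesis using vnb[of b] ab anc by (metis insert_commute)
    next
      case 3 then show ?thesis using vnb[of a] ab anc by metis
    next
      case 4 then show ?thesis using IH(15) ab mono by (meson subsetD)
    qed auto
  qed
  have fin: "\<forall>x\<in>insert v S - set (v # u # st). \<forall>y. {x, y} \<in> E \<longrightarrow> y \<in> insert v S"
    using IH(14) by (metis DiffD1 DiffD2 DiffI insertE insertI2 list.set_intros(1) list.simps(15))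
  have acyc: "acyclic ?T" using IH(7) novu by (simp add: acyclic_insert)
  have uniq: "\<forall>a b c. (a, c) \<in> ?T \<longrightarrow> (b, c) \<in> ?T \<longrightarrow> a = b"
    using IH(4,11) advance.hyps(3) by blast
  have root: "\<forall>a. (a, r) \<notin> ?T" using IH(1,10) advance.hyps(3) by auto
  show ?case
    by (intro conjI sorted reach comp fin acyc uniq root card)
      (insert IH(1-6,12) vV advance.hyps(2), simp_all, blast+)
next
  case (retreat u st S T)
  note IH = retreat.IH[OF retreat.prems]
  have "\<forall>x\<in>S - set (u # st). \<forall>y. {x, y} \<in> E \<longrightarrow> y \<in> S" using IH by (elim conjE) assumption
  then have "\<forall>x\<in>S - set st. \<forall>y. {x, y} \<in> E \<longrightarrow> y \<in> S"
    using retreat.hyps(2) by (metis DiffD1 DiffD2 DiffI set_ConsD)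
  moreover have "set st \<subseteq> S" "sorted_wrt (\<lambda>x y. (y, x) \<in> T\<^sup>*) st"
    using IH by (elim conjE, simp only: list.set insert_subset sorted_wrt.simps)+
  ultimately show ?case using IH by (elim conjE) (intro conjI; assumption)
qed

section \<open>Rooted trees and vertical paths\<close>

locale rooted_tree =
  fixes V :: "'a set" and r :: 'a and T :: "('a \<times> 'a) set"
  assumes fin: "finite V" and sub: "T \<subseteq> V \<times> V" and rV: "r \<in> V"
    and reach: "v \<in> V \<Longrightarrow> (r, v) \<in> T\<^sup>*"
    and root: "(a, r) \<notin> T"
    and uniq: "(a, c) \<in> T \<Longrightarrow> (b, c) \<in> T \<Longrightarrow> a = b"
    and acyc: "acyclic T"
begin

lemma finT: "finite T"
  using fin sub by (meson finite_SigmaI finite_subset)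

lemma wfT: "wf (T\<inverse>)"
  using finT acyc by (simp add: finite_acyclic_wf_converse)

lemma antisym: "(a, b) \<in> T\<^sup>* \<Longrightarrow> (b, a) \<in> T\<^sup>* \<Longrightarrow> a = b"
  using acyc by (meson acyclic_impl_antisym_rtrancl antisymD)

lemma in_V: "(a, b) \<in> T\<^sup>* \<Longrightarrow> a \<in> V \<Longrightarrow> b \<in> V"
  by (induction rule: rtrancl_induct) (use sub in auto)

lemma anc_in_V: "(a, b) \<in> T\<^sup>* \<Longrightarrow> b \<in> V \<Longrightarrow> a \<in> V"
  by (induction rule: converse_rtrancl_induct) (use sub in auto)

lemma linear: "(a, c) \<in> T\<^sup>* \<Longrightarrow> (b, c) \<in> T\<^sup>* \<Longrightarrow> (a, b) \<in> T\<^sup>* \<or> (b, a) \<in> T\<^sup>*"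
proof (induction rule: rtrancl_induct)
  case base
  then show ?case by auto
next
  case (step y z)
  from step.prems show ?case
  proof (cases rule: rtranclE)
    case base
    then show ?thesis using step by (meson rtrancl.rtrancl_into_rtrancl)
  next
    case (step y')
    then have "y' = y" using step.hyps uniq by (metis \<open>(y, z) \<in> T\<close>)
    then show ?thesis using step step.IH by auto
  qed
qed

lemma anc_parent:
  assumes "(a, b) \<in> T" and "(x, b) \<in> T\<^sup>*" and "x \<noteq> b"
  shows "(x, a) \<in> T\<^sup>*"
  using assms uniq by (metis rtranclE)

text \<open>An edge enters the subtree of \<open>c\<close> from outside only at \<open>c\<close>, and leaves it only from \<open>c\<close>
  to its parent.\<close>

lemma walk_subtree:
  assumes "successively (\<lambda>x y. (x, y) \<in> T \<or> (y, x) \<in> T) (x # xs)"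
    and "(p, c) \<in> T" and "(c, x) \<in> T\<^sup>*" and "p \<notin> set (x # xs)" and "y \<in> set (x # xs)"
  shows "(c, y) \<in> T\<^sup>*"
  using assms
proof (induction xs arbitrary: x)
  case (Cons z xs)
  have "(c, z) \<in> T\<^sup>*"
  proof (cases "(x, z) \<in> T")
    case True
    then show ?thesis using Cons.prems by auto
  next
    case False
    then have zx: "(z, x) \<in> T" using Cons.prems by auto
    then have "x \<noteq> c" using Cons.prems uniq by auto
    then show ?thesis using anc_parent zx Cons.prems by blast
  qed
  then show ?case using Cons.IH[of z] Cons.prems by auto
qed auto

lemma walk_outside:
  assumes "successively (\<lambda>x y. (x, y) \<in> T \<or> (y, x) \<in> T) (x # xs)"
    and "(c, x) \<notin> T\<^sup>*" and "c \<notin> set (x # xs)" and "y \<in> set (x # xs)"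
  shows "(c, y) \<notin> T\<^sup>*"
  using assms
proof (induction xs arbitrary: x)
  case (Cons z xs)
  have "(c, z) \<notin> T\<^sup>*"
  proof (cases "(x, z) \<in> T")
    case True
    then show ?thesis using Cons.prems anc_parent by auto
  next
    case False
    then have zx: "(z, x) \<in> T" using Cons.prems by auto
    then show ?thesis using Cons.prems by (meson rtrancl.rtrancl_into_rtrancl)
  qed
  then show ?case using Cons.IH[of z] Cons.prems by auto
qed auto

text \<open>The first step cannot go up: it would leave the subtree of \<open>p\<close>, and a walk
  that avoids \<open>p\<close> never returns there, although \<open>q\<close> lies in it. After a
  first step down to \<open>x\<close> the walk is confined to the subtree of \<open>x\<close>, so
  the induction hypothesis applies to the rest.\<close>

lemma tree_path_descending:
  assumes "tree_path T p xs q" and "(p, q) \<in> T\<^sup>*"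
  shows "successively (\<lambda>x y. (x, y) \<in> T) xs"
  using assms
proof (induction xs arbitrary: p)
  case (Cons p' xs)
  then have [simp]: "p' = p" by (simp add: tree_path_def)
  show ?case
  proof (cases xs)
    case (Cons x ys)
    have walk: "successively (\<lambda>x y. (x, y) \<in> T \<or> (y, x) \<in> T) (x # ys)" "p \<notin> set (x # ys)"
      "q \<in> set (x # ys)" "(p, x) \<in> T \<or> (x, p) \<in> T"
      using Cons.prems(1) Cons by (auto simp: tree_path_def)
    have px: "(p, x) \<in> T"
    proof (rule ccontr)
      assume "(p, x) \<notin> T"
      then have "(x, p) \<in> T" using walk by auto
      then have "(p, x) \<notin> T\<^sup>*" using acyc by (meson acyclic_def rtrancl_into_trancl1)
      from walk_outside[OF walk(1) this walk(2,3)] show False using Cons.prems(2) by simp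
    qed
    have "(x, q) \<in> T\<^sup>*" using walk_subtree[OF walk(1) px _ walk(2,3)] by auto
    moreover have "tree_path T x xs q" using Cons.prems(1) Cons by (auto simp: tree_path_def)
    ultimately have "successively (\<lambda>x y. (x, y) \<in> T) xs" using Cons.IH by blast
    then show ?thesis using px Cons by auto
  qed auto
qed auto

text \<open>Turns membership in a path into two ancestor tests. For the less obvious inclusion, a
  vertex \<open>x\<close> between \<open>a\<close> and \<open>last ys\<close> is comparable with
  \<open>hd ys\<close>; if it is strictly above \<open>hd ys\<close>, it is also above the parent
  \<open>a\<close> of \<open>hd ys\<close> and hence equal to \<open>a\<close>.\<close>

lemma chain_set:
  assumes "successively (\<lambda>x y. (x, y) \<in> T) xs" and "xs \<noteq> []"
  shows "x \<in> set xs \<longleftrightarrow> (hd xs, x) \<in> T\<^sup>* \<and> (x, last xs) \<in> T\<^sup>*"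
  using assms
proof (induction xs arbitrary: x)
  case (Cons a ys)
  show ?case
  proof (cases "ys = []")
    case True
    then show ?thesis using antisym by auto
  next
    case False
    then have ys: "successively (\<lambda>x y. (x, y) \<in> T) ys" "(a, hd ys) \<in> T"
      using Cons.prems by (auto simp: successively_Cons)
    note IH = Cons.IH[OF ys(1) False]
    have al: "(a, last ys) \<in> T\<^sup>*" using IH[of "hd ys"] False ys(2)
      by (meson converse_rtrancl_into_rtrancl hd_in_set)
    have *: "(hd ys, x) \<in> T\<^sup>*" if x: "(a, x) \<in> T\<^sup>*" "(x, last ys) \<in> T\<^sup>*" "x \<noteq> a"
    proof -
      have "(hd ys, last ys) \<in> T\<^sup>*" using IH[of "hd ys"] False by auto
      then consider "(hd ys, x) \<in> T\<^sup>*" | "(x, hd ys) \<in> T\<^sup>*" using linear x(2) by metis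
      then show ?thesis
      proof cases
        case 2
        then have "x = hd ys \<or> (x, a) \<in> T\<^sup>*" using anc_parent[OF ys(2)] by metis
        then show ?thesis using x antisym by auto
      qed
    qed
    have **: "(a, x) \<in> T\<^sup>*" if "(hd ys, x) \<in> T\<^sup>*"
      using that ys(2) by (rule converse_rtrancl_into_rtrancl[rotated])
    show ?thesis
      using IH[of x] * ** al False by fastforce
  qed
qed auto

lemma chain_sorted:
  assumes "successively (\<lambda>x y. (x, y) \<in> T) xs"
  shows "sorted_wrt (\<lambda>x y. (x, y) \<in> T\<^sup>+) xs"
proof -
  have "successively (\<lambda>x y. (x, y) \<in> T\<^sup>+) xs"
    using assms by (rule successively_mono) auto
  then show ?thesis by (subst (asm) successively_iff_sorted_wrt_strong) (auto intro: trancl_trans)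
qed

end

text \<open>Successor of an event in the Euler tour, where \<open>(v, False)\<close> is the event of entering \<open>v\<close>,
  \<open>(v, True)\<close> that of leaving it, and \<open>ch v\<close> lists the children of \<open>v\<close>.\<close>

definition tour_step :: "('a \<Rightarrow> 'a list) \<Rightarrow> 'a \<times> bool \<Rightarrow> 'a \<times> bool \<Rightarrow> bool" where
  "tour_step ch e e' \<longleftrightarrow>
     (if snd e then \<exists>p as bs. ch p = as @ fst e # bs \<and> e' = (if bs = [] then (p, True) else (hd bs, False))
      else e' = (if ch (fst e) = [] then (fst e, True) else (hd (ch (fst e)), False)))"

section \<open>Existence and nesting of Euler tours\<close>

context rooted_tree
begin

text \<open>The program follows the tour by the local rule \<open>tour_step\<close>, whereas the
  ancestor test needs the global nesting in the last conjunct. Carrying both lets a single induction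
  provide them.\<close>

definition euler_tour :: "('a \<Rightarrow> 'a list) \<Rightarrow> 'a \<Rightarrow> ('a \<times> bool) list \<Rightarrow> bool" where
  "euler_tour ch v l \<longleftrightarrow>
     l \<noteq> [] \<and> hd l = (v, False) \<and> last l = (v, True) \<and> distinct l \<and> successively (tour_step ch) l \<and>
     set l = {x. (v, x) \<in> T\<^sup>*} \<times> UNIV \<and>
     (\<forall>x. (v, x) \<in> T\<^sup>* \<longrightarrow> (\<exists>l1 l2 l3. l = l1 @ (x, False) # l2 @ (x, True) # l3 \<and>
        set l2 = {y. (x, y) \<in> T\<^sup>+} \<times> UNIV))"

text \<open>Well-founded induction from the leaves upwards: the tour of \<open>v\<close> puts the
  two events of \<open>v\<close> around the concatenated tours of its children.\<close>

lemma euler_tour_exists: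
  assumes ch: "\<And>v. distinct (ch v)" "\<And>v. set (ch v) = {c. (v, c) \<in> T}"
  shows "\<exists>l. euler_tour ch v l"
  using wfT
proof (induction v rule: wf_induct_rule)
  case (less v)
  then have "\<forall>c. \<exists>l. (v, c) \<in> T \<longrightarrow> euler_tour ch c l" by fastforce
  then obtain f where "\<And>c. (v, c) \<in> T \<Longrightarrow> euler_tour ch c (f c)" by metis
  note f = this[unfolded euler_tour_def]
  let ?m = "concat (map f (ch v))"
  let ?l = "(v, False) # ?m @ [(v, True)]"
  have below: "(v, x) \<in> T\<^sup>+ \<longleftrightarrow> (\<exists>c. (v, c) \<in> T \<and> (c, x) \<in> T\<^sup>*)" for x
    by (meson rtrancl_into_trancl2 tranclD)
  have setm: "set ?m = {y. (v, y) \<in> T\<^sup>+} \<times> UNIV"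
    using f below by (auto simp: ch(2))
  have nov: "(v, v) \<notin> T\<^sup>+" using acyc by (simp add: acyclic_def)
  \<comment> \<open>Subtrees of distinct siblings are disjoint: a common vertex would make the
    siblings comparable, so that one of them would be above the parent \<open>v\<close> of the
    other.\<close>
  have dm: "distinct (concat (map f bs))" if "distinct bs" "set bs \<subseteq> set (ch v)" for bs
    using that
  proof (induction bs)
    case (Cons b bs)
    have "set (f b) \<inter> set (f c) = {}" if "c \<in> set bs" for c
    proof -
      have bc: "(v, b) \<in> T" "(v, c) \<in> T" "b \<noteq> c" using Cons.prems that ch(2) by auto
      then have "\<not> ((b, x) \<in> T\<^sup>* \<and> (c, x) \<in> T\<^sup>*)" for x
        using linear[of b x c] anc_parent[of v c b] anc_parent[of v b c] antisym[of b v] antisym[of c v] nov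
        by (metis r_into_rtrancl trancl.r_into_trancl)
      then show ?thesis using f bc by auto
    qed
    then show ?case using Cons f[of b] by (fastforce simp: ch(2))
  qed auto
  \<comment> \<open>Generalised to suffixes \<open>bs\<close> of the child list, because the event
    after the exit of a child is determined by the siblings that remain.\<close>
  have succ: "successively (tour_step ch) (concat (map f bs) @ [(v, True)]) \<and>
      hd (concat (map f bs) @ [(v, True)]) = (if bs = [] then (v, True) else (hd bs, False))"
    if "ch v = as @ bs" for as bs
    using that
  proof (induction bs arbitrary: as)
    case (Cons b bs)
    have b: "(v, b) \<in> T" using Cons.prems ch(2)[of v] by auto
    have "tour_step ch (b, True) (if bs = [] then (v, True) else (hd bs, False))"
      using Cons.prems by (auto simp: tour_step_def)
    then show ?case using Cons.IH[of "as @ [b]"] Cons.prems f[OF b]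
      by (auto simp: successively_append_iff hd_append)
  qed auto
  have P: "\<exists>l1 l2 l3. ?l = l1 @ (x, False) # l2 @ (x, True) # l3 \<and> set l2 = {y. (x, y) \<in> T\<^sup>+} \<times> UNIV"
    if x: "(v, x) \<in> T\<^sup>*" for x
  proof (cases "x = v")
    case True
    then show ?thesis using setm by (intro exI[of _ "[]"] exI[of _ ?m]) auto
  next
    case False
    then obtain c where c: "(v, c) \<in> T" "(c, x) \<in> T\<^sup>*" using x below by (metis rtranclD)
    then obtain as bs where ab: "ch v = as @ c # bs" using ch(2) by (metis CollectI split_list)
    from f[OF c(1)] c(2) obtain l1 l2 l3 where
      l: "f c = l1 @ (x, False) # l2 @ (x, True) # l3" "set l2 = {y. (x, y) \<in> T\<^sup>+} \<times> UNIV" by blast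
    show ?thesis
      by (intro exI[of _ "(v, False) # concat (map f as) @ l1"] exI[of _ l2]
          exI[of _ "l3 @ concat (map f bs) @ [(v, True)]"]) (auto simp: ab l)
  qed
  have "euler_tour ch v ?l" unfolding euler_tour_def
    using succ[of "[]" "ch v"] P dm[OF ch(1)] setm nov
    by (auto simp: successively_Cons tour_step_def dest: rtranclD)
  then show ?case by blast
qed

end

section \<open>Running programs\<close>

text \<open>Meant for loop-free code. Mapping a loop to \<open>False\<close> makes \<open>wp\<close>
  a total-correctness condition and keeps the default value 0 of \<open>max_time\<close> for loops
  sound in \<open>wp_runs\<close>; loops are treated by \<open>runs_While\<close>.\<close>

fun wp :: "nat \<Rightarrow> com \<Rightarrow> (state \<Rightarrow> bool) \<Rightarrow> state \<Rightarrow> bool" where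
  "wp W Skip Q s \<longleftrightarrow> Q s"
| "wp W (Assign i a) Q s \<longleftrightarrow> fits W s a \<and> Q (s\<lparr>reg := (reg s)(i := val s a)\<rparr>)"
| "wp W (Store a b) Q s \<longleftrightarrow> fits W s a \<and> fits W s b \<and> Q (s\<lparr>mem := (mem s)(val s a := val s b)\<rparr>)"
| "wp W (Seq p q) Q s \<longleftrightarrow> wp W p (wp W q Q) s"
| "wp W (Cond b p q) Q s \<longleftrightarrow> fits W s b \<and> (if val s b \<noteq> 0 then wp W p Q s else wp W q Q s)"
| "wp W (While b p) Q s \<longleftrightarrow> False"

fun max_time :: "com \<Rightarrow> nat" where
  "max_time Skip = 1"
| "max_time (Assign i a) = cost a + 1"
| "max_time (Store a b) = cost a + cost b + 1"
| "max_time (Seq p q) = max_time p + max_time q"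
| "max_time (Cond b p q) = cost b + 1 + max (max_time p) (max_time q)"
| "max_time (While b p) = 0"

definition runs :: "nat \<Rightarrow> com \<Rightarrow> nat \<Rightarrow> (state \<Rightarrow> bool) \<Rightarrow> state \<Rightarrow> bool" where
  "runs W p t Q s \<longleftrightarrow> (\<exists>t' s'. exec W p s t' s' \<and> t' \<le> t \<and> Q s')"

lemma wp_Seq: "wp W (Seq p q) Q = wp W p (wp W q Q)"
  by (rule ext) simp

lemma wp_runs: "wp W p Q s \<Longrightarrow> runs W p (max_time p) Q s"
proof (induction p arbitrary: Q s)
  case (Seq p q)
  then have "runs W p (max_time p) (wp W q Q) s" by simp
  then obtain t s' where 1: "exec W p s t s'" "t \<le> max_time p" "wp W q Q s'" by (auto simp: runs_def)
  then obtain t' s'' where "exec W q s' t' s''" "t' \<le> max_time q" "Q s''"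
    using Seq.IH(2)[of Q s'] by (auto simp: runs_def)
  with 1 show ?case unfolding runs_def by (intro exI[of _ "t + t'"] exI[of _ s'']) (auto intro: exec.Seq)
next
  case (Cond b p q)
  show ?case
  proof (cases "val s b = 0")
    case True
    with Cond obtain t s' where "exec W q s t s'" "t \<le> max_time q" "Q s'" by (fastforce simp: runs_def)
    with True Cond.prems show ?thesis
      unfolding runs_def by (intro exI[of _ "cost b + 1 + t"] exI[of _ s']) (simp add: exec.CondFalse del: One_nat_def add_Suc_right)
  next
    case False
    with Cond obtain t s' where "exec W p s t s'" "t \<le> max_time p" "Q s'" by (fastforce simp: runs_def)
    with False Cond.prems show ?thesis
      unfolding runs_def by (intro exI[of _ "cost b + 1 + t"] exI[of _ s']) (simp add: exec.CondTrue del: One_nat_def add_Suc_right)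
  qed
next
  case Skip
  then show ?case unfolding runs_def using exec.Skip by fastforce
next
  case (Assign i a)
  then show ?case unfolding runs_def using exec.Assign by fastforce
next
  case (Store a b)
  then show ?case unfolding runs_def using exec.Store by fastforce
qed auto

lemma wp_mono: "wp W p Q s \<Longrightarrow> (\<And>s. Q s \<Longrightarrow> Q' s) \<Longrightarrow> wp W p Q' s"
  by (induction p arbitrary: Q Q' s) (auto split: if_splits)

lemma runs_Seq:
  assumes "runs W p t R s" and "\<And>s. R s \<Longrightarrow> runs W q t' Q s"
  shows "runs W (Seq p q) (t + t') Q s"
proof -
  obtain t1 s1 where 1: "exec W p s t1 s1" "t1 \<le> t" "R s1" using assms(1) by (auto simp: runs_def)
  then obtain t2 s2 where 2: "exec W q s1 t2 s2" "t2 \<le> t'" "Q s2"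
    using assms(2)[OF 1(3)] by (auto simp: runs_def)
  with 1 show ?thesis unfolding runs_def by (intro exI[of _ "t1 + t2"] exI[of _ s2]) (auto intro: exec.Seq)
qed

lemma runs_weaken:
  assumes "runs W p t Q s" and "t \<le> t'" and "\<And>s. Q s \<Longrightarrow> Q' s"
  shows "runs W p t' Q' s"
  using assms by (auto simp: runs_def intro: le_trans)

text \<open>The index \<open>k\<close> is a potential. It drops strictly in every iteration and
  therefore bounds their number, while the last \<open>cost b + 1\<close> pays for the failing
  test.\<close>

lemma runs_While:
  assumes "I k s" and "\<And>k s. I k s \<Longrightarrow> fits W s b"
    and body: "\<And>k s. I k s \<Longrightarrow> val s b \<noteq> 0 \<Longrightarrow> wp W p (\<lambda>s'. \<exists>k'<k. I k' s') s"
  shows "runs W (While b p) (k * (cost b + 1 + max_time p) + cost b + 1) (\<lambda>s. (\<exists>k. I k s) \<and> val s b = 0) s"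
  using assms(1)
proof (induction k arbitrary: s rule: less_induct)
  case (less k)
  show ?case
  proof (cases "val s b = 0")
    case True
    then show ?thesis unfolding runs_def
      using exec.WhileFalse[OF assms(2)[OF less.prems] True, of p] less.prems True
      by (intro exI[of _ "cost b + 1"] exI[of _ s]) auto
  next
    case False
    obtain t1 s1 k' where 1: "exec W p s t1 s1" "t1 \<le> max_time p" "k' < k" "I k' s1"
      using wp_runs[OF body[OF less.prems False]] by (auto simp: runs_def)
    obtain t2 s2 where 2: "exec W (While b p) s1 t2 s2" "t2 \<le> k' * (cost b + 1 + max_time p) + cost b + 1"
      "(\<exists>k. I k s2) \<and> val s2 b = 0"
      using less.IH[OF 1(3,4)] by (auto simp: runs_def)
    have "Suc k' * (cost b + 1 + max_time p) \<le> k * (cost b + 1 + max_time p)"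
      using 1(3) by (intro mult_right_mono) auto
    then have "cost b + 1 + t1 + t2 \<le> k * (cost b + 1 + max_time p) + cost b + 1"
      using 1(2) 2(2) by simp
    moreover have "exec W (While b p) s (cost b + 1 + t1 + t2) s2"
      using exec.WhileTrue[OF assms(2)[OF less.prems] False 1(1) 2(1)] .
    ultimately show ?thesis using 2(3) unfolding runs_def by blast
  qed
qed

lemma runs_for:
  assumes "J 0 s" and cond: "\<And>i s. J i s \<Longrightarrow> i \<le> N \<Longrightarrow> fits W s b \<and> (val s b \<noteq> 0 \<longleftrightarrow> i < N)"
    and body: "\<And>i s. J i s \<Longrightarrow> i < N \<Longrightarrow> wp W p (J (Suc i)) s"
  shows "runs W (While b p) (N * (cost b + 1 + max_time p) + cost b + 1) (J N) s"
proof -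
  have "runs W (While b p) (N * (cost b + 1 + max_time p) + cost b + 1)
      (\<lambda>s. (\<exists>k. \<exists>i. i + k = N \<and> J i s) \<and> val s b = 0) s"
  proof (rule runs_While)
    fix k s assume I: "\<exists>i. i + k = N \<and> J i s" and "val s b \<noteq> 0"
    then obtain i where i: "i + k = N" "J i s" "i < N" using cond by force
    show "wp W p (\<lambda>s'. \<exists>k'<k. \<exists>i. i + k' = N \<and> J i s') s"
    proof (rule wp_mono[OF body[OF i(2,3)]])
      fix s assume "J (Suc i) s"
      then show "\<exists>k'<k. \<exists>i. i + k' = N \<and> J i s"
        using i by (intro exI[of _ "k - 1"]) (auto intro!: exI[of _ "Suc i"])
    qed
  qed (use assms in auto)
  then show ?thesis
  proof (rule runs_weaken)
    fix s assume "(\<exists>k i. i + k = N \<and> J i s) \<and> val s b = 0"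
    then obtain i where "i \<le> N" "J i s" "val s b = 0" using le_add1 by blast
    then show "J N s" using cond[of i s] by auto
  qed simp
qed

abbreviation seq_infix (infixr ";;" 60) where "p ;; q \<equiv> Seq p q"
abbreviation add_infix (infixl "\<oplus>" 65) where "a \<oplus> b \<equiv> Bin Add a b"
abbreviation sub_infix (infixl "\<ominus>" 65) where "a \<ominus> b \<equiv> Bin Sub a b"
abbreviation mul_infix (infixl "\<otimes>" 70) where "a \<otimes> b \<equiv> Bin Mul a b"
abbreviation less_infix (infix "\<prec>" 50) where "a \<prec> b \<equiv> Bin Less a b"
abbreviation eq_infix (infix "\<doteq>" 50) where "a \<doteq> b \<equiv> Bin Eq a b"

section \<open>Arrays and bucket lists in memory\<close>

definition arr :: "(nat \<Rightarrow> nat) \<Rightarrow> nat \<Rightarrow> nat \<Rightarrow> (nat \<Rightarrow> nat) \<Rightarrow> bool" where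
  "arr M b l f \<longleftrightarrow> (\<forall>i<l. M (b + i) = f i)"

lemma arr_lookup: "arr M b l f \<Longrightarrow> i < l \<Longrightarrow> M (b + i) = f i"
  by (simp add: arr_def)

lemma arr_other: "arr M b l f \<Longrightarrow> a < b \<or> b + l \<le> a \<Longrightarrow> arr (M(a := x)) b l f"
  by (auto simp: arr_def)

text \<open>Linked lists of array indices; a link holds the successor of the index it points to,
  and \<open>0\<close> is the null pointer.\<close>

fun linked :: "(nat \<Rightarrow> nat) \<Rightarrow> nat \<Rightarrow> nat list \<Rightarrow> bool" where
  "linked nx h [] \<longleftrightarrow> h = 0"
| "linked nx h (x # xs) \<longleftrightarrow> h = Suc x \<and> linked nx (nx x) xs"

lemma linked_cong: "(\<And>x. x \<in> set xs \<Longrightarrow> nx' x = nx x) \<Longrightarrow> linked nx' h xs = linked nx h xs"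
  by (induction xs arbitrary: h) auto

lemma linked_next: "linked nx h (xs @ v # ys) \<Longrightarrow> nx v = (if ys = [] then 0 else Suc (hd ys))"
  by (induction xs arbitrary: h) (auto, (cases ys, auto)+)

lemma linked_head: "linked nx h xs \<Longrightarrow> h = (if xs = [] then 0 else Suc (hd xs))"
  by (cases xs) auto

text \<open>All lists share one array of links, so an index has a single link cell and can sit in
  one list only. This is why \<open>buckets_push\<close> asks that the pushed index occur in no
  bucket.\<close>

definition buckets :: "(nat \<Rightarrow> nat) \<Rightarrow> nat \<Rightarrow> nat \<Rightarrow> nat \<Rightarrow> nat \<Rightarrow> (nat \<Rightarrow> nat list) \<Rightarrow> bool" where
  "buckets M hb nb N L b \<longleftrightarrow>
     (\<forall>k<N. linked (\<lambda>i. M (nb + i)) (M (hb + k)) (b k) \<and> set (b k) \<subseteq> {..<L})"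

lemma buckets_other:
  assumes "buckets M hb nb N L b" and "a < hb \<or> hb + N \<le> a" and "a < nb \<or> nb + L \<le> a"
  shows "buckets (M(a := x)) hb nb N L b"
  unfolding buckets_def
proof (intro allI impI)
  fix k assume k: "k < N"
  have "linked (\<lambda>i. (M(a := x)) (nb + i)) h (b k) = linked (\<lambda>i. M (nb + i)) h (b k)" for h
    by (rule linked_cong) (use assms k in \<open>fastforce simp: buckets_def\<close>)
  then show "linked (\<lambda>i. (M(a := x)) (nb + i)) ((M(a := x)) (hb + k)) (b k) \<and> set (b k) \<subseteq> {..<L}"
    using assms k by (auto simp: buckets_def)
qed

lemma buckets_push:
  assumes "buckets M hb nb N L b" and "k < N" and "x < L" and "\<And>k. k < N \<Longrightarrow> x \<notin> set (b k)"
    and "hb + N \<le> nb \<or> nb + L \<le> hb"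
  shows "buckets (M(nb + x := M (hb + k), hb + k := Suc x)) hb nb N L (b(k := x # b k))"
  unfolding buckets_def
proof (intro allI impI)
  let ?M = "M(nb + x := M (hb + k), hb + k := Suc x)"
  fix k' assume k': "k' < N"
  have "linked (\<lambda>i. ?M (nb + i)) h (b k') = linked (\<lambda>i. M (nb + i)) h (b k')" for h
    by (rule linked_cong) (use assms k' in \<open>fastforce simp: buckets_def\<close>)
  then show "linked (\<lambda>i. ?M (nb + i)) (?M (hb + k')) ((b(k := x # b k)) k') \<and> set ((b(k := x # b k)) k') \<subseteq> {..<L}"
    using assms k' by (auto simp: buckets_def)
qed

lemma buckets_pop:
  assumes "buckets M hb nb N L b" and "k < N" and "b k = x # xs" and "hb + N \<le> nb \<or> nb + L \<le> hb"
  shows "buckets (M(hb + k := M (nb + x))) hb nb N L (b(k := xs))"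
  unfolding buckets_def
proof (intro allI impI)
  let ?M = "M(hb + k := M (nb + x))"
  fix k' assume k': "k' < N"
  have "linked (\<lambda>i. ?M (nb + i)) h xs' = linked (\<lambda>i. M (nb + i)) h xs'"
    if "set xs' \<subseteq> {..<L}" for h xs'
    by (rule linked_cong) (use assms k' that in fastforce)
  then show "linked (\<lambda>i. ?M (nb + i)) (?M (hb + k')) ((b(k := xs)) k') \<and> set ((b(k := xs)) k') \<subseteq> {..<L}"
    using assms k' by (force simp: buckets_def)
qed

lemma buckets_head:
  assumes "buckets M hb nb N L b" and "k < N"
  shows "M (hb + k) = (if b k = [] then 0 else Suc (hd (b k)))" and "M (hb + k) \<le> L"
    and "b k \<noteq> [] \<Longrightarrow> hd (b k) < L"
proof -
  have *: "linked (\<lambda>i. M (nb + i)) (M (hb + k)) (b k)" "set (b k) \<subseteq> {..<L}"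
    using assms by (auto simp: buckets_def)
  from linked_head[OF *(1)] show "M (hb + k) = (if b k = [] then 0 else Suc (hd (b k)))" .
  then show "M (hb + k) \<le> L" "b k \<noteq> [] \<Longrightarrow> hd (b k) < L"
    using *(2) by (cases "b k"; auto)+
qed

lemma buckets_next:
  assumes "buckets M hb nb N L b" and "k < N" and "b k = xs @ x # ys"
  shows "M (nb + x) = (if ys = [] then 0 else Suc (hd ys))" and "M (nb + x) \<le> L"
proof -
  have *: "linked (\<lambda>i. M (nb + i)) (M (hb + k)) (xs @ x # ys)" "set (b k) \<subseteq> {..<L}"
    using assms by (force simp: buckets_def)+
  from linked_next[OF *(1)] show "M (nb + x) = (if ys = [] then 0 else Suc (hd ys))" .
  then show "M (nb + x) \<le> L"
    using *(2) assms(3) by (cases ys) simp_all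
qed

definition bucket_sort :: "('a \<Rightarrow> nat) \<Rightarrow> nat \<Rightarrow> 'a list \<Rightarrow> 'a list" where
  "bucket_sort key N xs = concat (map (\<lambda>k. filter (\<lambda>x. key x = k) xs) [0..<N])"

text \<open>Stability: \<open>filter\<close> preserves the old order inside a bucket, and keys
  increase from bucket to bucket. Hence two passes give a lexicographic order.\<close>

lemma sorted_wrt_bucket_sort:
  assumes "sorted_wrt R xs"
  shows "sorted_wrt (\<lambda>x y. key x < key y \<or> key x = key y \<and> R x y) (bucket_sort key N xs)"
proof (induction N)
  case (Suc N)
  have "sorted_wrt (\<lambda>x y. key x < key y \<or> key x = key y \<and> R x y) (filter (\<lambda>x. key x = k) xs)" for k
  proof -
    have "sorted_wrt R (filter (\<lambda>x. key x = k) xs)" using assms by (rule sorted_wrt_filter)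
    then show ?thesis by (rule sorted_wrt_mono_rel[rotated]) auto
  qed
  then show ?case using Suc by (auto simp: bucket_sort_def sorted_wrt_append)
qed (simp add: bucket_sort_def)

lemma set_bucket_sort: "(\<And>x. x \<in> set xs \<Longrightarrow> key x < N) \<Longrightarrow> set (bucket_sort key N xs) = set xs"
  by (auto simp: bucket_sort_def)

lemma distinct_bucket_sort:
  assumes "distinct xs"
  shows "distinct (bucket_sort key N xs)"
proof (induction N)
  case (Suc N)
  then show ?case using assms by (auto simp: bucket_sort_def)
qed (simp add: bucket_sort_def)

definition push :: "nat \<Rightarrow> nat \<Rightarrow> nat \<Rightarrow> nat \<Rightarrow> com" where
  "push hb nb k x =
     Store (Reg nb \<oplus> Reg x) (Load (Reg hb \<oplus> Reg k)) ;; Store (Reg hb \<oplus> Reg k) (Reg x \<oplus> Const 1)"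

text \<open>One loop both empties the buckets and advances through them. Two nested loops would be
  more natural, but the body of a loop has to be loop-free for \<open>runs_While\<close>.\<close>

definition drain :: "nat \<Rightarrow> nat \<Rightarrow> com \<Rightarrow> com" where
  "drain hb nb p =
     While (Reg 3 \<prec> Const 2 \<otimes> Reg 0)
      (Assign 6 (Load (Reg hb \<oplus> Reg 3)) ;;
       Cond (Reg 6)
         (Assign 7 (Reg 6 \<ominus> Const 1) ;; Store (Reg hb \<oplus> Reg 3) (Load (Reg nb \<oplus> Reg 7)) ;; p)
         (Assign 3 (Reg 3 \<oplus> Const 1)))"

text \<open>The potential \<open>N - i + length rest\<close> pays for skipping an empty bucket as well as for
  removing an element.\<close>

lemma runs_drain:
  assumes init: "reg s 3 = 0" "buckets (mem s) H X N L b" "Inv [] s"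
    and regs: "\<And>seq s. Inv seq s \<Longrightarrow> 2 * reg s 0 = N \<and> reg s hb = H \<and> reg s nb = X"
    and regs_ne: "hb \<notin> {3, 6, 7}" "nb \<notin> {3, 6, 7}"
    and Inv_reg: "\<And>seq s i x. Inv seq s \<Longrightarrow> i \<in> {3, 6, 7} \<Longrightarrow> Inv seq (s\<lparr>reg := (reg s)(i := x)\<rparr>)"
    and Inv_mem: "\<And>seq s k x. Inv seq s \<Longrightarrow> k < N \<Longrightarrow> Inv seq (s\<lparr>mem := (mem s)(H + k := x)\<rparr>)"
    and disj: "H + N \<le> X \<or> X + L \<le> H"
    and W: "2 < W" "H + N < W" "X + L < W"
    and body: "\<And>seq x s b'. \<lbrakk>Inv seq s; reg s 7 = x; x < L; seq @ x # concat b' = concat (map b [0..<N]); reg s 3 < N\<rbrakk> \<Longrightarrow>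
       wp W p (\<lambda>s'. Inv (seq @ [x]) s' \<and> reg s' 3 = reg s 3 \<and>
          (\<forall>a \<in> {H..<H + N} \<union> {X..<X + L}. mem s' a = mem s a)) s"
  shows "runs W (drain hb nb p) ((N + length (concat (map b [0..<N]))) * (30 + max_time p) + 20)
    (\<lambda>s. Inv (concat (map b [0..<N])) s) s"
proof -
  define all where "all = concat (map b [0..<N])"
  \<comment> \<open>\<open>seq\<close> is what has been handed to \<open>p\<close> so far and
    \<open>b'\<close> the remaining contents; together they always spell the fixed list
    \<open>all\<close>.\<close>
  define I where "I k s \<longleftrightarrow> (\<exists>seq b' i. i \<le> N \<and> reg s 3 = i \<and> Inv seq s \<and> buckets (mem s) H X N L b' \<and>
      seq @ concat (map b' [i..<N]) = all \<and> k = N - i + length (concat (map b' [i..<N])))" for k s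
  let ?b = "Reg 3 \<prec> Const 2 \<otimes> Reg 0"
  let ?p = "Assign 6 (Load (Reg hb \<oplus> Reg 3)) ;;
       Cond (Reg 6)
         (Assign 7 (Reg 6 \<ominus> Const 1) ;; Store (Reg hb \<oplus> Reg 3) (Load (Reg nb \<oplus> Reg 7)) ;; p)
         (Assign 3 (Reg 3 \<oplus> Const 1))"
  have "runs W (While ?b ?p) ((N + length all) * (cost ?b + 1 + max_time ?p) + cost ?b + 1)
     (\<lambda>s. (\<exists>k. I k s) \<and> val s ?b = 0) s"
  proof (rule runs_While)
    show "I (N + length all) s"
      unfolding I_def all_def using init by (intro exI[of _ "[]"] exI[of _ b] exI[of _ 0]) auto
  next
    fix k s assume "I k s"
    then obtain seq where "reg s 3 \<le> N" "Inv seq s" unfolding I_def by auto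
    then show "fits W s ?b" using regs[of seq s] W by auto
  next
    fix k s assume "I k s" and v: "val s ?b \<noteq> 0"
    then obtain seq b' where I: "reg s 3 \<le> N" "Inv seq s" "buckets (mem s) H X N L b'"
      "seq @ concat (map b' [reg s 3..<N]) = all" "k = N - reg s 3 + length (concat (map b' [reg s 3..<N]))"
      unfolding I_def by auto
    define i where "i = reg s 3"
    have R: "2 * reg s 0 = N" "reg s hb = H" "reg s nb = X" using regs[OF I(2)] by auto
    then have i: "i < N" using v by (auto simp: i_def split: if_splits)
    have up: "[i..<N] = i # [Suc i..<N]" using i by (simp add: upt_conv_Cons)
    note h = buckets_head[OF I(3) i]
    show "wp W ?p (\<lambda>s'. \<exists>k'<k. I k' s') s"
    proof (cases "b' i")
      case Nil
      then have 0: "mem s (H + i) = 0" using h by simp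
      let ?s = "s\<lparr>reg := (reg s)(6 := 0, 3 := Suc i)\<rparr>"
      have "Inv seq ?s" using Inv_reg[OF Inv_reg[OF I(2), of 6 0], of 3 "Suc i"] by simp
      then have "I (k - 1) ?s" unfolding I_def
        using i I Nil up by (intro exI[of _ seq] exI[of _ b'] exI[of _ "Suc i"]) (auto simp: i_def[symmetric])
      moreover have "k - 1 < k" using I(5) i by (simp add: i_def)
      ultimately have "\<exists>k'<k. I k' ?s" by blast
      then show ?thesis using R W i 0 regs_ne by (auto simp: i_def[symmetric])
    next
      case (Cons x xs)
      then have x: "mem s (H + i) = Suc x" "x < L" using h by auto
      have nx: "mem s (X + x) \<le> L" using buckets_next(2)[OF I(3) i, of "[]" x xs] Cons by simp
      let ?s = "s\<lparr>reg := (reg s)(6 := Suc x, 7 := x), mem := (mem s)(H + i := mem s (X + x))\<rparr>"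
      have inv: "Inv seq ?s"
        using Inv_mem[OF Inv_reg[OF Inv_reg[OF I(2), of 6 "Suc x"], of 7 x], of i "mem s (X + x)"] i by simp
      have bu: "buckets (mem ?s) H X N L (b'(i := xs))"
        using buckets_pop[OF I(3) i Cons disj] by simp
      have all: "seq @ x # concat (xs # map b' [Suc i..<N]) = concat (map b [0..<N])"
        using I(4) Cons up by (simp add: i_def[symmetric] all_def)
      have map_eq: "map (b'(i := xs)) [i..<N] = xs # map b' [Suc i..<N]" using up by simp
      have "wp W p (\<lambda>s'. \<exists>k'<k. I k' s') ?s"
      proof (rule wp_mono[OF body[OF inv _ x(2) all]])
        fix s' assume s': "Inv (seq @ [x]) s' \<and> reg s' 3 = reg ?s 3 \<and>
          (\<forall>a \<in> {H..<H + N} \<union> {X..<X + L}. mem s' a = mem ?s a)"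
        then have "reg s' 3 = i" and "Inv (seq @ [x]) s'" by (simp_all add: i_def)
        \<comment> \<open>The body \<open>p\<close> leaves all head and link cells alone, so the
          lists that are still to be drained survive it.\<close>
        have "linked (\<lambda>j. mem s' (X + j)) h ys = linked (\<lambda>j. mem ?s (X + j)) h ys" if "set ys \<subseteq> {..<L}" for h ys
          by (rule linked_cong) (use that s' in force)
        then have "buckets (mem s') H X N L (b'(i := xs))"
          using bu s' unfolding buckets_def by (simp del: fun_upd_apply)
        then have "I (k - 1) s'" unfolding I_def
          using \<open>reg s' 3 = i\<close> \<open>Inv (seq @ [x]) s'\<close> i I(4,5) all map_eq up Cons
          by (intro exI[of _ "seq @ [x]"] exI[of _ "b'(i := xs)"] exI[of _ i])
             (auto simp: i_def[symmetric] all_def simp del: fun_upd_apply)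
        moreover have "k - 1 < k" using I(5) i by (simp add: i_def)
        ultimately show "\<exists>k'<k. I k' s'" by blast
      qed (use i in \<open>auto simp: i_def\<close>)
      then show ?thesis using R W i x nx regs_ne by (auto simp: i_def[symmetric])
    qed
  qed
  then show ?thesis
    unfolding drain_def all_def[symmetric]
  proof (rule runs_weaken)
    fix s assume "(\<exists>k. I k s) \<and> val s ?b = 0"
    then obtain seq b' where "reg s 3 \<le> N" "Inv seq s" "seq @ concat (map b' [reg s 3..<N]) = all"
      "\<not> reg s 3 < 2 * reg s 0" unfolding I_def by (auto split: if_splits)
    then show "Inv all s" using regs[of seq s] by auto
  next
    show "(N + length all) * (cost ?b + 1 + max_time ?p) + cost ?b + 1 \<le> (N + length all) * (30 + max_time p) + 20"
    proof -
      have "(N + length all) * (cost ?b + 1 + max_time ?p) \<le> (N + length all) * (30 + max_time p)"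
        by (rule mult_left_mono) auto
      then show ?thesis by simp
    qed
  qed
qed

section \<open>Packing several fields into a word\<close>

fun horner :: "nat \<Rightarrow> nat list \<Rightarrow> nat" where
  "horner B [] = 0"
| "horner B (f # fs) = f + B * horner B fs"

lemma horner_digit:
  assumes "\<forall>f\<in>set fs. f < B" and "j < length fs"
  shows "horner B fs div B ^ j mod B = fs ! j"
  using assms
proof (induction fs arbitrary: j)
  case (Cons f fs)
  show ?case
  proof (cases j)
    case (Suc j')
    then have "horner B (f # fs) div B ^ j = (f + B * horner B fs) div B div B ^ j'"
      by (simp add: div_mult2_eq)
    also have "(f + B * horner B fs) div B = horner B fs"
      using Cons.prems(1) by (auto simp: div_mult_self2)
    finally show ?thesis using Cons Suc by simp
  qed (use Cons.prems in simp)
qed simp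

lemma horner_less: "\<forall>f\<in>set fs. f < B \<Longrightarrow> horner B fs < B ^ length fs"
proof (induction fs)
  case (Cons f fs)
  then have "f + B * horner B fs < B * (1 + horner B fs)" by simp
  also have "\<dots> \<le> B * B ^ length fs" using Cons by (intro mult_left_mono) auto
  finally show ?case by simp
qed simp

text \<open>For \<open>b\<close> a power of two, \<open>b\<close> is the largest power of two dividing \<open>pack b fs\<close>; this lets a
  query recover the base from a single word.\<close>

definition pack :: "nat \<Rightarrow> nat list \<Rightarrow> nat" where
  "pack b fs = b + 2 * b * horner (b * b) fs"

lemma unpack:
  assumes "0 < b" and "\<forall>f\<in>set fs. f < b * b" and "j < length fs"
  shows "pack b fs div (2 * b * (b * b) ^ j) mod (b * b) = fs ! j"
proof -
  have "pack b fs div (2 * b * (b * b) ^ j) = pack b fs div (2 * b) div (b * b) ^ j"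
    by (simp add: div_mult2_eq)
  also have "pack b fs div (2 * b) = horner (b * b) fs"
    using assms(1) by (simp add: pack_def div_mult_self2)
  finally show ?thesis using horner_digit[OF assms(2,3)] by simp
qed

lemma pack_less:
  assumes "0 < b" and "\<forall>f\<in>set fs. f < b * b"
  shows "pack b fs < 2 * b * (b * b) ^ length fs"
proof -
  have "pack b fs < 2 * b * (1 + horner (b * b) fs)" using assms(1) by (simp add: pack_def)
  also have "\<dots> \<le> 2 * b * (b * b) ^ length fs"
    using horner_less[OF assms(2)] by (intro mult_left_mono) auto
  finally show ?thesis .
qed

fun horner_exp :: "exp \<Rightarrow> exp list \<Rightarrow> exp" where
  "horner_exp B [] = Const 0"
| "horner_exp B (f # fs) = f \<oplus> B \<otimes> horner_exp B fs"

lemma val_horner_exp: "val s (horner_exp B fs) = horner (val s B) (map (val s) fs)"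
  by (induction fs) auto

text \<open>With a positive base, the values in Horner's scheme only grow from the inside out, so a
  bound on the final value bounds every intermediate one.\<close>

lemma fits_horner_exp:
  assumes "fits W s B" "0 < val s B" "\<forall>f\<in>set fs. fits W s f" "horner (val s B) (map (val s) fs) < W"
  shows "fits W s (horner_exp B fs)"
  using assms(3,4)
proof (induction fs)
  case (Cons f fs)
  let ?h = "horner (val s B) (map (val s) fs)"
  have "val s B * ?h < W" using Cons.prems(2) by simp
  moreover have "?h \<le> val s B * ?h" using assms(2) by simp
  ultimately have "?h < W" by (rule le_less_trans[rotated])
  then show ?case using Cons.IH Cons.prems assms(1) \<open>val s B * ?h < W\<close> by (simp add: val_horner_exp)
qed simp

section \<open>The construction\<close>

text \<open>Registers 0 to 2 hold \<open>n\<close>, \<open>m\<close> and the radix \<open>b\<close>, a power of two above \<open>n\<close>; register 3 is the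
  loop counter. Registers 10 to 20 hold the base addresses of the arrays of parents, heads and links of
  the child lists, entry and exit times, upper and lower ends of the edges, and heads and links of
  the buckets of the two sorting passes.\<close>

definition compute_bases :: com where
  "compute_bases =
     Assign 0 (Load (Const 0)) ;; Assign 1 (Load (Const 1)) ;;
     Assign 10 (Const 2 \<oplus> Const 2 \<otimes> Reg 1) ;; Assign 11 (Reg 10 \<oplus> Reg 0) ;; Assign 12 (Reg 11 \<oplus> Reg 0) ;;
     Assign 13 (Reg 12 \<oplus> Reg 0) ;; Assign 14 (Reg 13 \<oplus> Reg 0) ;; Assign 15 (Reg 14 \<oplus> Reg 0) ;;
     Assign 16 (Reg 15 \<oplus> Reg 1) ;; Assign 17 (Reg 16 \<oplus> Reg 1) ;; Assign 18 (Reg 17 \<oplus> Const 2 \<otimes> Reg 0) ;;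
     Assign 19 (Reg 18 \<oplus> Reg 1) ;; Assign 20 (Reg 19 \<oplus> Const 2 \<otimes> Reg 0) ;; Assign 2 (Const 1)"

definition compute_radix :: com where
  "compute_radix = While (Reg 2 \<prec> Reg 0 \<oplus> Const 1) (Assign 2 (Const 2 \<otimes> Reg 2))"

text \<open>The root is recognised as its own parent and put into register 4, where the tour expects
  its first vertex.\<close>

definition list_children :: com where
  "list_children = While (Reg 3 \<prec> Reg 0)
     (Assign 6 (Load (Reg 10 \<oplus> Reg 3)) ;;
      Cond (Reg 6 \<doteq> Reg 3) (Assign 4 (Reg 3)) (push 11 12 6 3) ;;
      Assign 3 (Reg 3 \<oplus> Const 1))"

text \<open>Registers 4 and 5 encode the current event, with 1 in register 5 for leaving. Sibling
  links and the parent array lead onwards from an exit, so the traversal needs neither recursion nor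
  a stack.\<close>

definition walk_tour :: com where
  "walk_tour = While (Reg 3 \<prec> Const 2 \<otimes> Reg 0)
     (Cond (Reg 5)
        (Store (Reg 14 \<oplus> Reg 4) (Reg 3) ;; Assign 6 (Load (Reg 12 \<oplus> Reg 4)) ;;
         Cond (Reg 6) (Assign 4 (Reg 6 \<ominus> Const 1) ;; Assign 5 (Const 0)) (Assign 4 (Load (Reg 10 \<oplus> Reg 4))))
        (Store (Reg 13 \<oplus> Reg 4) (Reg 3) ;; Assign 6 (Load (Reg 11 \<oplus> Reg 4)) ;;
         Cond (Reg 6) (Assign 4 (Reg 6 \<ominus> Const 1)) (Assign 5 (Const 1))) ;;
      Assign 3 (Reg 3 \<oplus> Const 1))"

definition orient_edges :: com where
  "orient_edges = While (Reg 3 \<prec> Reg 1)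
     (Assign 6 (Load (Const 2 \<oplus> Const 2 \<otimes> Reg 3)) ;; Assign 7 (Load (Const 3 \<oplus> Const 2 \<otimes> Reg 3)) ;;
      Cond (Load (Reg 13 \<oplus> Reg 6) \<prec> Load (Reg 13 \<oplus> Reg 7)) Skip
        (Assign 8 (Reg 6) ;; Assign 6 (Reg 7) ;; Assign 7 (Reg 8)) ;;
      Store (Reg 15 \<oplus> Reg 3) (Reg 6) ;; Store (Reg 16 \<oplus> Reg 3) (Reg 7) ;;
      Assign 8 (Load (Reg 13 \<oplus> Reg 6)) ;; push 17 18 8 3 ;;
      Assign 3 (Reg 3 \<oplus> Const 1))"

definition sort_edges :: com where
  "sort_edges = drain 17 18
     (Assign 8 (Load (Reg 13 \<oplus> Load (Reg 16 \<oplus> Reg 7))) ;; push 19 20 8 7)"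

text \<open>There may be more words than vertices; reducing the index modulo \<open>n\<close> keeps
  the lookup of an entry time within its array.\<close>

definition word_exp :: exp where
  "word_exp = Reg 2 \<oplus> (Const 2 \<otimes> Reg 2) \<otimes> horner_exp (Reg 21)
     [Load (Reg 13 \<oplus> Load (Reg 16 \<oplus> Reg 7)), Load (Reg 13 \<oplus> Load (Reg 15 \<oplus> Reg 7)),
      Load (Reg 14 \<oplus> Load (Reg 15 \<oplus> Reg 7)), Load (Reg 15 \<oplus> Reg 7),
      Load (Reg 13 \<oplus> Bin Mod (Reg 9 \<oplus> Const 1) (Reg 0)), Load (Reg 13), Reg 1]"

text \<open>The words overwrite the beginning of the input. By then \<open>n\<close> and
  \<open>m\<close> are in registers and the ends of the edges have been copied to arrays further
  up.\<close>

definition write_words :: com where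
  "write_words = drain 19 20 (Store (Reg 9) word_exp ;; Assign 9 (Reg 9 \<oplus> Const 1))"

definition build_program :: com where
  "build_program =
     compute_bases ;; compute_radix ;; Assign 21 (Reg 2 \<otimes> Reg 2) ;; list_children ;;
     (Assign 3 (Const 0) ;; Assign 5 (Const 0)) ;; walk_tour ;; Assign 3 (Const 0) ;; orient_edges ;;
     Assign 3 (Const 0) ;; sort_edges ;; (Assign 3 (Const 0) ;; Assign 9 (Const 0)) ;; write_words"

section \<open>The input tree, its edge list and its Euler tour\<close>

locale dfs_input =
  fixes n m :: nat and E :: "nat set set" and r :: nat and T :: "(nat \<times> nat) set"
    and es :: "(nat \<times> nat) list" and par :: "nat list"
  assumes graph: "ugraph {..<n} E" and card_E: "card E = m"
    and tree: "dfs_tree {..<n} E r T" and rep: "represents n E r T es par"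
begin

lemma dfs_facts:
  "r < n" "T \<subseteq> {..<n} \<times> {..<n}" "acyclic T" "card T + 1 = n" "\<forall>v\<in>{..<n}. (r, v) \<in> T\<^sup>*" "\<forall>a. (a, r) \<notin> T"
  "\<forall>a b c. (a, c) \<in> T \<longrightarrow> (b, c) \<in> T \<longrightarrow> a = b" "\<forall>a b. (a, b) \<in> T \<longrightarrow> {a, b} \<in> E"
  "\<forall>a\<in>{..<n}. \<forall>b\<in>{..<n}. {a, b} \<in> E \<longrightarrow> (a, b) \<in> T\<^sup>* \<or> (b, a) \<in> T\<^sup>*"
proof -
  have "dfs E r [] {..<n} T" "r \<in> {..<n}" using tree by (auto simp: dfs_tree_def)
  note I = dfs_invariant[OF this(1) graph this(2)]
  from I show "T \<subseteq> {..<n} \<times> {..<n}" by (elim conjE)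
  from I show "acyclic T" by (elim conjE)
  from I show "\<forall>v\<in>{..<n}. (r, v) \<in> T\<^sup>*" by (elim conjE)
  from I show "\<forall>a. (a, r) \<notin> T" by (elim conjE)
  from I show "\<forall>a b c. (a, c) \<in> T \<longrightarrow> (b, c) \<in> T \<longrightarrow> a = b" by (elim conjE)
  from I show "\<forall>a b. (a, b) \<in> T \<longrightarrow> {a, b} \<in> E" by (elim conjE)
  from I show "\<forall>a\<in>{..<n}. \<forall>b\<in>{..<n}. {a, b} \<in> E \<longrightarrow> (a, b) \<in> T\<^sup>* \<or> (b, a) \<in> T\<^sup>*" by (elim conjE)
  from I have "card T + 1 = card {..<n}" by (elim conjE)
  then show "card T + 1 = n" by simp
  from \<open>r \<in> {..<n}\<close> show "r < n" by simp
qed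

lemma edge_bounds: "{a, b} \<in> E \<Longrightarrow> a < n \<and> b < n \<and> a \<noteq> b"
  using graph by (auto simp: ugraph_def)

lemma dfs_props:
  "acyclic T" "r < n" "T \<subseteq> {..<n} \<times> {..<n}" "v < n \<Longrightarrow> (r, v) \<in> T\<^sup>*" "(a, r) \<notin> T"
  "(a, c) \<in> T \<Longrightarrow> (b, c) \<in> T \<Longrightarrow> a = b" "card T + 1 = n" "(a, b) \<in> T \<Longrightarrow> {a, b} \<in> E"
  "{a, b} \<in> E \<Longrightarrow> (a, b) \<in> T\<^sup>* \<or> (b, a) \<in> T\<^sup>*"
proof -
  show "acyclic T" "r < n" "T \<subseteq> {..<n} \<times> {..<n}" "card T + 1 = n" by (rule dfs_facts)+
  show "v < n \<Longrightarrow> (r, v) \<in> T\<^sup>*" using dfs_facts(5) by blast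
  show "(a, r) \<notin> T" using dfs_facts(6) by blast
  show "(a, c) \<in> T \<Longrightarrow> (b, c) \<in> T \<Longrightarrow> a = b" using dfs_facts(7) by blast
  show "(a, b) \<in> T \<Longrightarrow> {a, b} \<in> E" using dfs_facts(8) by blast
  show "{a, b} \<in> E \<Longrightarrow> (a, b) \<in> T\<^sup>* \<or> (b, a) \<in> T\<^sup>*" using dfs_facts(9) edge_bounds[of a b] by blast
qed

sublocale rooted_tree "{..<n}" r T
proof
  show "(a, c) \<in> T \<Longrightarrow> (b, c) \<in> T \<Longrightarrow> a = b" for a b c by (rule dfs_props(6))
qed (use dfs_props(1-5) in simp_all)

text \<open>Forgetting the orientation embeds the \<open>n - 1\<close> tree edges into
  \<open>E\<close>, as acyclicity rules out opposite pairs. This provides a word for each vertex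
  other than \<open>0\<close>.\<close>

lemma n_le: "n \<le> m + 1"
proof -
  have "finite E" using graph unfolding ugraph_def by (meson Pow_iff finite_Pow_iff finite_subset subsetI)
  moreover have "inj_on (\<lambda>(a, b). {a, b}) T"
    by (intro inj_onI) (use dfs_props(1,6) in \<open>auto simp: doubleton_eq_iff acyclic_def
        dest: trancl_into_trancl[OF r_into_trancl]\<close>)
  moreover have "(\<lambda>(a, b). {a, b}) ` T \<subseteq> E" using dfs_props(8) by auto
  ultimately have "card T \<le> card E" by (metis card_image card_mono)
  then show ?thesis using dfs_props(7) card_E by simp
qed

lemma m_le: "m \<le> n * n"
proof -
  have "E \<subseteq> (\<lambda>(a, b). {a, b}) ` ({..<n} \<times> {..<n})"
  proof
    fix e assume "e \<in> E"
    then have "card e = 2" "e \<subseteq> {..<n}" using graph by (auto simp: ugraph_def)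
    then show "e \<in> (\<lambda>(a, b). {a, b}) ` ({..<n} \<times> {..<n})" by (auto simp: card_2_iff image_iff)
  qed
  then have "card E \<le> card ({..<n} \<times> {..<n})"
    by (meson card_image_le card_mono finite_SigmaI finite_imageI finite_lessThan order_trans)
  then show ?thesis using card_E by simp
qed

lemma edge_list: "length es = m" "length par = n" "par ! r = r"
  "v < n \<Longrightarrow> v \<noteq> r \<Longrightarrow> (par ! v, v) \<in> T" "j < m \<Longrightarrow> {fst (es ! j), snd (es ! j)} \<in> E"
  "E = (\<lambda>j. {fst (es ! j), snd (es ! j)}) ` {..<m}"
proof -
  show l: "length es = m" and "length par = n" "par ! r = r" "v < n \<Longrightarrow> v \<noteq> r \<Longrightarrow> (par ! v, v) \<in> T"
    using rep card_E by (auto simp: represents_def)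
  have "E = (\<lambda>e. {fst e, snd e}) ` set es" using rep by (auto simp: represents_def split_beta)
  then show "E = (\<lambda>j. {fst (es ! j), snd (es ! j)}) ` {..<m}"
    using l by (simp add: set_conv_nth image_image lessThan_def setcompr_eq_image)
  then show "j < m \<Longrightarrow> {fst (es ! j), snd (es ! j)} \<in> E" by auto
qed

lemma par_eq_iff: "v < n \<Longrightarrow> par ! v = v \<longleftrightarrow> v = r"
  using edge_list(3,4) dfs_props(1) by (metis acyclic_def r_into_trancl')

lemma par_less: "v < n \<Longrightarrow> par ! v < n"
  using edge_list(3,4) dfs_props(2,3) by (metis lessThan_iff mem_Sigma_iff subsetD)

lemma r_less: "r < n" by (rule dfs_props)

text \<open>The order is reversed because pushing puts the latest child in front: this is literally
  the list in memory after \<open>i\<close> rounds of \<open>list_children\<close>.\<close>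

definition children_upto :: "nat \<Rightarrow> nat \<Rightarrow> nat list" where
  "children_upto i v = filter (\<lambda>c. c \<noteq> r \<and> par ! c = v) (rev [0..<i])"

definition tour :: "(nat \<times> bool) list" where
  "tour = (SOME l. euler_tour (children_upto n) r l)"

lemma set_children: "set (children_upto n v) = {c. (v, c) \<in> T}"
proof -
  have "(v, c) \<in> T \<longleftrightarrow> c < n \<and> c \<noteq> r \<and> par ! c = v" for c
    using edge_list(4) dfs_props(3,5,6) by blast
  then show ?thesis by (auto simp: children_upto_def)
qed

lemma euler_tour_tour: "euler_tour (children_upto n) r tour"
  unfolding tour_def
  by (rule someI_ex, rule euler_tour_exists) (use set_children in \<open>auto simp: children_upto_def\<close>)

lemmas tour_raw = euler_tour_tour[unfolded euler_tour_def]

lemma set_tour: "set tour = {..<n} \<times> UNIV"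
proof -
  have "{x. (r, x) \<in> T\<^sup>*} = {..<n}" using dfs_props(2,4) in_V by blast
  then show ?thesis using tour_raw by metis
qed

lemma length_tour: "length tour = 2 * n"
  using distinct_card[of tour] tour_raw by (simp add: set_tour card_cartesian_product)

lemma tour_hd: "tour ! 0 = (r, False)"
  using tour_raw by (metis hd_conv_nth)

lemma tour_succ: "Suc t < 2 * n \<Longrightarrow> tour_step (children_upto n) (tour ! t) (tour ! Suc t)"
  using tour_raw length_tour by (auto simp: successively_conv_nth)

definition clock :: "nat \<times> bool \<Rightarrow> nat" where
  "clock e = (THE t. t < 2 * n \<and> tour ! t = e)"

abbreviation tin :: "nat \<Rightarrow> nat" where "tin v \<equiv> clock (v, False)"
abbreviation tout :: "nat \<Rightarrow> nat" where "tout v \<equiv> clock (v, True)"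

lemma clock_nth: "t < 2 * n \<Longrightarrow> clock (tour ! t) = t"
  unfolding clock_def
  using tour_raw length_tour by (intro the_equality) (auto simp: nth_eq_iff_index_eq)

lemma clock:
  assumes "v < n"
  shows "clock (v, f) < 2 * n" and "tour ! clock (v, f) = (v, f)"
proof -
  have "(v, f) \<in> set tour" using assms set_tour by auto
  then obtain t where "t < 2 * n" "tour ! t = (v, f)" by (metis in_set_conv_nth length_tour)
  then show "clock (v, f) < 2 * n" "tour ! clock (v, f) = (v, f)" using clock_nth by metis+
qed

lemma tin_inj: "v < n \<Longrightarrow> w < n \<Longrightarrow> tin v = tin w \<Longrightarrow> v = w"
  using clock(2) by (metis prod.inject)

text \<open>By the nesting of the tour, the events strictly between the two of \<open>v\<close> are
  exactly those of its proper descendants. Locating the entry of \<open>w\<close> is therefore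
  enough.\<close>

lemma ancestor_iff:
  assumes "v < n" and "w < n"
  shows "(v, w) \<in> T\<^sup>* \<longleftrightarrow> tin v \<le> tin w \<and> tin w \<le> tout v"
proof -
  obtain l1 l2 l3 where l: "tour = l1 @ (v, False) # l2 @ (v, True) # l3" "set l2 = {y. (v, y) \<in> T\<^sup>+} \<times> UNIV"
    using tour_raw dfs_props(4)[OF assms(1)] by blast
  have len: "length l1 + length l2 + length l3 + 2 = 2 * n" using length_tour l(1) by simp
  have tv: "tin v = length l1"
    using clock_nth[of "length l1"] len by (simp add: l(1))
  have "tour ! (length l1 + Suc (length l2)) = (v, True)"
    unfolding l(1) nth_append_length_plus by simp
  then have ov: "tout v = length l1 + Suc (length l2)"
    using clock_nth[of "length l1 + Suc (length l2)"] len by simp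
  have nth: "tour ! (length l1 + Suc i) = l2 ! i" if "i < length l2" for i
    unfolding l(1) nth_append_length_plus using that by (simp add: nth_append)
  show ?thesis
  proof
    assume "(v, w) \<in> T\<^sup>*"
    then consider "w = v" | "(v, w) \<in> T\<^sup>+" by (metis rtranclD)
    then show "tin v \<le> tin w \<and> tin w \<le> tout v"
    proof cases
      case 2
      then have "(w, False) \<in> set l2" using l(2) by auto
      then obtain i where i: "i < length l2" "l2 ! i = (w, False)" by (metis in_set_conv_nth)
      then have "tin w = length l1 + Suc i"
        using nth clock_nth[of "length l1 + Suc i"] len by simp
      then show ?thesis using tv ov i by simp
    qed (use tv ov in simp)
  next
    assume le: "tin v \<le> tin w \<and> tin w \<le> tout v"
    have "tin w \<noteq> tout v" using clock(2) assms by (metis prod.inject)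
    then have "tin w = length l1 \<or> tin w = length l1 + Suc (tin w - length l1 - 1) \<and> tin w - length l1 - 1 < length l2"
      using le tv ov by arith
    then consider "tin w = length l1" | i where "tin w = length l1 + Suc i" "i < length l2" by blast
    then show "(v, w) \<in> T\<^sup>*"
    proof cases
      case 1
      then show ?thesis using tin_inj[OF assms] tv by simp
    next
      case 2
      then have "(w, False) = l2 ! i" using nth clock(2)[OF assms(2)] by metis
      then have "(w, False) \<in> set l2" using 2 by simp
      then show ?thesis using l(2) by (auto simp: trancl_into_rtrancl)
    qed
  qed
qed

end

lemma concat_pairs:
  "length (concat (map (\<lambda>(a, b). [a, b]) xs)) = 2 * length xs"
  "j < length xs \<Longrightarrow> concat (map (\<lambda>(a, b). [a, b]) xs) ! (2 * j) = fst (xs ! j)"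
  "j < length xs \<Longrightarrow> concat (map (\<lambda>(a, b). [a, b]) xs) ! Suc (2 * j) = snd (xs ! j)"
proof -
  show "length (concat (map (\<lambda>(a, b). [a, b]) xs)) = 2 * length xs"
    by (induction xs) auto
  show "j < length xs \<Longrightarrow> concat (map (\<lambda>(a, b). [a, b]) xs) ! (2 * j) = fst (xs ! j)"
    by (induction xs arbitrary: j) (auto simp: nth_Cons split: nat.split)
  show "j < length xs \<Longrightarrow> concat (map (\<lambda>(a, b). [a, b]) xs) ! Suc (2 * j) = snd (xs ! j)"
    by (induction xs arbitrary: j) (auto simp: nth_Cons split: nat.split)
qed

section \<open>Word size, radix and memory layout\<close>

locale dfs_run = dfs_input +
  fixes W :: nat
  assumes W: "W = (n + 1) ^ 40"
begin

definition J :: nat where "J = (LEAST j. n < 2 ^ j)"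
definition b :: nat where "b = 2 ^ J"

lemma b_bounds: "n < b" "b \<le> 2 * n" "0 < b"
proof -
  have ex: "n < 2 ^ n" by simp
  then show "n < b" unfolding b_def J_def by (rule LeastI)
  show "0 < b" by (simp add: b_def)
  have "J \<noteq> 0" using \<open>n < b\<close> r_less by (auto simp: b_def intro: ccontr)
  then obtain J' where J': "J = Suc J'" by (cases J) auto
  then have "\<not> n < 2 ^ J'" using not_less_Least[of J' "\<lambda>j. n < 2 ^ j"] by (simp add: J_def)
  then show "b \<le> 2 * n" using J' by (simp add: b_def)
qed

lemma J_le: "J \<le> n"
  unfolding J_def by (rule Least_le) simp

lemma less_J_iff: "j \<le> J \<Longrightarrow> 2 ^ j \<le> n \<longleftrightarrow> j < J"
  using b_bounds(1) not_less_Least[of j "\<lambda>j. n < 2 ^ j"]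
  by (auto simp: b_def J_def[symmetric] le_less)

text \<open>Seven digits to base \<open>b * b\<close> and the factor \<open>2 * b\<close> keep a
  packed word below \<open>2 * b ^ 15\<close>. With \<open>N = n + 1\<close> and the coarse bound
  \<open>b \<le> N * N\<close> this is at most \<open>N ^ 31\<close>, the factor 2 being absorbed by
  \<open>N\<close>. Addresses stay below \<open>N ^ 12\<close>, because
  \<open>1000 \<le> 2 ^ 10 \<le> N ^ 10\<close>. The exponent 40 is a generous choice above
  both.\<close>

lemma W_bounds: "1000 * (n + m + 1) \<le> W" "2 * b * (b * b) ^ 7 \<le> W" "m < b * b" "2 * n \<le> b * b"
proof -
  define N where "N = n + 1"
  have N: "2 \<le> N" using r_less by (simp add: N_def)
  have "n + m + 1 \<le> N * N" using m_le by (simp add: N_def algebra_simps)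
  moreover have "1000 \<le> N ^ 10" using power_mono[OF N, of 10] by simp
  ultimately have "1000 * (n + m + 1) \<le> N ^ 10 * (N * N)" by (intro mult_mono) simp_all
  also have "\<dots> = N ^ 12" by (simp add: eval_nat_numeral)
  also have "\<dots> \<le> N ^ 40" using N by (intro power_increasing) auto
  finally show "1000 * (n + m + 1) \<le> W" by (simp add: W N_def)
  have "b \<le> N * N" using b_bounds(2) by (simp add: N_def algebra_simps)
  then have "b ^ 15 \<le> (N * N) ^ 15" by (rule power_mono) simp
  then have "2 * b ^ 15 \<le> N * (N * N) ^ 15" using N by (intro mult_mono) auto
  also have "\<dots> = N ^ 31" by (simp add: power_mult_distrib flip: power_add power_Suc)
  also have "\<dots> \<le> N ^ 40" using N by (intro power_increasing) auto
  finally have "2 * b ^ 15 \<le> W" by (simp only: W N_def)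
  moreover have "2 * b * (b * b) ^ 7 = 2 * b ^ 15" by (simp add: power_mult_distrib mult.assoc flip: power_add power_Suc)
  ultimately show "2 * b * (b * b) ^ 7 \<le> W" by simp
  have "Suc n * Suc n \<le> b * b" using b_bounds(1) by (intro mult_mono) auto
  then show "m < b * b" "2 * n \<le> b * b" using m_le by auto
qed

lemma radix_less: "b < W" "2 * b < W" "b * b < W"
proof -
  show "b < W" "2 * b < W" using b_bounds(2) W_bounds(1) by simp_all
  have "b * b < 2 * (b * b)" using b_bounds(3) by simp
  also have "\<dots> \<le> 2 * b * (b * b) ^ 7"
    using b_bounds(3) self_le_power[of "b * b" 7] by (intro mult_mono) auto
  finally show "b * b < W" using W_bounds(2) by (rule less_le_trans)
qed

definition "PAR = 2 + 2 * m"
definition "HD = PAR + n"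
definition "NX = HD + n"
definition "IN = NX + n"
definition "OUT = IN + n"
definition "AA = OUT + n"
definition "DD = AA + m"
definition "H1 = DD + m"
definition "N1 = H1 + 2 * n"
definition "H2 = N1 + m"
definition "N2 = H2 + 2 * n"

lemmas base_defs = PAR_def HD_def NX_def IN_def OUT_def AA_def DD_def H1_def N1_def H2_def N2_def

lemma layout:
  "2 + 2 * m \<le> PAR" "PAR + n \<le> HD" "HD + n \<le> NX" "NX + n \<le> IN" "IN + n \<le> OUT" "OUT + n \<le> AA"
  "AA + m \<le> DD" "DD + m \<le> H1" "H1 + 2 * n \<le> N1" "N1 + m \<le> H2" "H2 + 2 * n \<le> N2"
  "N2 + 10 * n + 10 * m + 10 \<le> W"
  using W_bounds(1) r_less by (simp_all add: base_defs)

definition env :: "state \<Rightarrow> bool" where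
  "env s \<longleftrightarrow> reg s 0 = n \<and> reg s 1 = m \<and> reg s 2 = b \<and> reg s 10 = PAR \<and> reg s 11 = HD \<and> reg s 12 = NX \<and>
     reg s 13 = IN \<and> reg s 14 = OUT \<and> reg s 15 = AA \<and> reg s 16 = DD \<and> reg s 17 = H1 \<and> reg s 18 = N1 \<and>
     reg s 19 = H2 \<and> reg s 20 = N2 \<and> reg s 21 = b * b"

lemma env_mem: "env (s\<lparr>mem := M\<rparr>) \<longleftrightarrow> env s"
  by (simp add: env_def)

definition edges :: "(nat \<Rightarrow> nat) \<Rightarrow> bool" where
  "edges M \<longleftrightarrow> (\<forall>j<m. M (2 + 2 * j) = fst (es ! j) \<and> M (3 + 2 * j) = snd (es ! j))"

lemma edges_other: "edges M \<Longrightarrow> PAR \<le> a \<Longrightarrow> edges (M(a := x))"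
  by (auto simp: edges_def PAR_def)

abbreviation "input \<equiv> build_input n es par"

lemma input_reg: "reg input = (\<lambda>_. 0)"
  by (simp add: build_input_def)

lemma input_memory: "mem input 0 = n" "mem input (Suc 0) = m" "edges (mem input)" "arr (mem input) PAR n ((!) par)"
  "HD \<le> a \<Longrightarrow> mem input a = 0"
proof -
  let ?L = "concat (map (\<lambda>(a, b). [a, b]) es)"
  show "mem input 0 = n" "mem input (Suc 0) = m" by (simp_all add: build_input_def words_def edge_list)
  have *: "mem input (2 + i) = (if i < 2 * m then ?L ! i else if i < 2 * m + n then par ! (i - 2 * m) else 0)" for i
    by (simp add: build_input_def words_def nth_append concat_pairs(1) edge_list(1,2))
  have "mem input (2 + 2 * j) = fst (es ! j) \<and> mem input (2 + Suc (2 * j)) = snd (es ! j)" if "j < m" for j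
    unfolding * using that concat_pairs(2,3)[of j es] by (simp add: edge_list(1))
  then show "edges (mem input)" by (simp add: edges_def numeral_3_eq_3)
  have "mem input (2 + (2 * m + i)) = par ! i" if "i < n" for i
    unfolding * using that by simp
  then show "arr (mem input) PAR n ((!) par)" by (simp add: arr_def PAR_def add.assoc)
  assume "HD \<le> a"
  then obtain i where a: "a = 2 + (2 * m + n + i)" by (auto simp: HD_def PAR_def le_iff_add add.assoc)
  show "mem input a = 0" unfolding a * by simp
qed

section \<open>Set-up, child lists and the walk along the tour\<close>

lemma runs_setup:
  "runs W (compute_bases ;; compute_radix ;; Assign 21 (Reg 2 \<otimes> Reg 2)) (100 * n + 200)
     (\<lambda>s. env s \<and> reg s 3 = 0 \<and> mem s = mem input) input"
proof -
  \<comment> \<open>\<open>env\<close> prescribes the final contents of registers 2 and 21, which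
    are still being computed here. It is therefore asserted of the state in which these two are
    overwritten.\<close>
  define R where "R i s \<longleftrightarrow> env (s\<lparr>reg := (reg s)(2 := b, 21 := b * b)\<rparr>) \<and> reg s 2 = 2 ^ i \<and> reg s 3 = 0 \<and> mem s = mem input" for i s
  have "wp W compute_bases (R 0) input"
    using W_bounds(1) r_less input_memory(1,2)
    by (simp add: compute_bases_def R_def env_def base_defs input_reg)
  then have 1: "runs W compute_bases 100 (R 0) input"
    by (rule runs_weaken[OF wp_runs]) (simp_all add: compute_bases_def)
  have 2: "runs W compute_radix (J * 50 + 50) (R J) s" if "R 0 s" for s
  proof -
    have "runs W compute_radix (J * (cost (Reg 2 \<prec> Reg 0 \<oplus> Const 1) + 1 + max_time (Assign 2 (Const 2 \<otimes> Reg 2))) + cost (Reg 2 \<prec> Reg 0 \<oplus> Const 1) + 1) (R J) s"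
      unfolding compute_radix_def
    proof (rule runs_for[where J = R, OF that])
      fix i s assume R: "R i s" "i \<le> J"
      have "(2::nat) ^ i \<le> b" using R(2) by (simp add: b_def)
      then show "fits W s (Reg 2 \<prec> Reg 0 \<oplus> Const 1) \<and> (val s (Reg 2 \<prec> Reg 0 \<oplus> Const 1) \<noteq> 0) = (i < J)"
        using R less_J_iff[of i] layout b_bounds by (auto simp: R_def env_def)
    next
      fix i s assume R: "R i s" "i < J"
      then have "(2::nat) ^ i \<le> n" using less_J_iff[of i] by simp
      then show "wp W (Assign 2 (Const 2 \<otimes> Reg 2)) (R (Suc i)) s"
        using R layout by (auto simp: R_def env_def)
    qed
    then show ?thesis by (rule runs_weaken) auto
  qed
  have 3: "runs W (Assign 21 (Reg 2 \<otimes> Reg 2)) 4 (\<lambda>s. env s \<and> reg s 3 = 0 \<and> mem s = mem input) s" if "R J s" for s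
  proof -
    have "wp W (Assign 21 (Reg 2 \<otimes> Reg 2)) (\<lambda>s. env s \<and> reg s 3 = 0 \<and> mem s = mem input) s"
      using that radix_less by (auto simp: R_def env_def b_def)
    then show ?thesis by (rule runs_weaken[OF wp_runs]) simp_all
  qed
  show ?thesis
    by (rule runs_weaken[OF runs_Seq[OF 1 runs_Seq[OF 2 3]]]) (use J_le in auto)
qed

text \<open>The bound on all link cells does not follow from \<open>buckets\<close>: the root is in
  no child list, yet its link cell is read when the tour leaves it. The zeros from \<open>AA\<close>
  on later serve as empty bucket heads.\<close>

definition inv_children :: "nat \<Rightarrow> state \<Rightarrow> bool" where
  "inv_children i s \<longleftrightarrow> env s \<and> reg s 3 = i \<and> edges (mem s) \<and> arr (mem s) PAR n ((!) par) \<and>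
     buckets (mem s) HD NX n n (children_upto i) \<and> (r < i \<longrightarrow> reg s 4 = r) \<and>
     (\<forall>v<n. mem s (NX + v) \<le> n) \<and> (\<forall>a\<ge>AA. mem s a = 0)"

lemma runs_list_children:
  assumes "env s" "reg s 3 = 0" "mem s = mem input"
  shows "runs W list_children (n * 100 + 100) (inv_children n) s"
proof -
  let ?b = "Reg 3 \<prec> Reg 0"
  let ?p = "Assign 6 (Load (Reg 10 \<oplus> Reg 3)) ;;
      Cond (Reg 6 \<doteq> Reg 3) (Assign 4 (Reg 3)) (push 11 12 6 3) ;;
      Assign 3 (Reg 3 \<oplus> Const 1)"
  have "runs W (While ?b ?p) (n * (cost ?b + 1 + max_time ?p) + cost ?b + 1) (inv_children n) s"
  proof (rule runs_for[where J = inv_children])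
    show "inv_children 0 s"
      using assms layout input_memory
      by (auto simp: inv_children_def children_upto_def buckets_def)
  next
    fix i s assume I: "inv_children i s" "i < n"
    have f: "env s" "reg s 3 = i" "edges (mem s)" "arr (mem s) PAR n ((!) par)"
     "buckets (mem s) HD NX n n (children_upto i)" "r < i \<longrightarrow> reg s 4 = r"
     "\<forall>v<n. mem s (NX + v) \<le> n" "\<forall>a\<ge>AA. mem s a = 0"
      using I by (auto simp: inv_children_def)
    have p: "mem s (PAR + i) = par ! i" "par ! i < n"
      using arr_lookup[OF f(4) I(2)] par_less[OF I(2)] by auto
    show "wp W ?p (inv_children (Suc i)) s"
    proof (cases "i = r")
      case True
      have "children_upto (Suc i) = children_upto i"
        by (rule ext) (simp add: children_upto_def True)
      then show ?thesis using True f p I(2) layout par_eq_iff[OF I(2)] r_less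
        by (auto simp: inv_children_def env_def)
    next
      case False
      then have ne: "par ! i \<noteq> i" using par_eq_iff[OF I(2)] by simp
      let ?M = "(mem s)(NX + i := mem s (HD + par ! i), HD + par ! i := Suc i)"
      have "children_upto (Suc i) = (children_upto i)(par ! i := i # children_upto i (par ! i))"
        by (rule ext) (auto simp: children_upto_def False)
      moreover have "buckets ?M HD NX n n ((children_upto i)(par ! i := i # children_upto i (par ! i)))"
        by (rule buckets_push[OF f(5) p(2) I(2)]) (use layout in \<open>auto simp: children_upto_def\<close>)
      ultimately have bu: "buckets ?M HD NX n n (children_upto (Suc i))" by simp
      have hd: "mem s (HD + par ! i) \<le> n" using buckets_head(2)[OF f(5) p(2)] .
      have "edges ?M" "arr ?M PAR n ((!) par)" "\<forall>v<n. ?M (NX + v) \<le> n" "\<forall>a\<ge>AA. ?M a = 0"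
        using f hd I(2) layout p by (simp_all add: edges_other arr_other)
      then show ?thesis using f p I(2) layout ne hd bu False
        by (simp add: inv_children_def env_def push_def)
    qed
  next
    fix i s assume "inv_children i s" "i \<le> n"
    then have "reg s 3 = i" "reg s 0 = n" by (simp_all add: inv_children_def env_def)
    then show "fits W s ?b \<and> (val s ?b \<noteq> 0) = (i < n)" using \<open>i \<le> n\<close> W_bounds(1) by simp
  qed
  then show ?thesis unfolding list_children_def
    by (rule runs_weaken) (simp_all add: push_def)
qed

text \<open>The guard is needed because the last iteration leaves no current event behind; only the
  ranges of the two registers persist.\<close>

definition tour_at :: "nat \<Rightarrow> state \<Rightarrow> bool" where
  "tour_at t s \<longleftrightarrow> reg s 4 < n \<and> reg s 5 \<le> 1 \<and> (t < 2 * n \<longrightarrow> tour ! t = (reg s 4, reg s 5 \<noteq> 0))"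

definition clocks_upto :: "nat \<Rightarrow> (nat \<Rightarrow> nat) \<Rightarrow> bool" where
  "clocks_upto t M \<longleftrightarrow>
     (\<forall>v<n. (tin v < t \<longrightarrow> M (IN + v) = tin v) \<and> (tout v < t \<longrightarrow> M (OUT + v) = tout v))"

definition inv_tour :: "nat \<Rightarrow> state \<Rightarrow> bool" where
  "inv_tour t s \<longleftrightarrow> env s \<and> reg s 3 = t \<and> edges (mem s) \<and> arr (mem s) PAR n ((!) par) \<and>
     buckets (mem s) HD NX n n (children_upto n) \<and> (\<forall>v<n. mem s (NX + v) \<le> n) \<and> (\<forall>a\<ge>AA. mem s a = 0) \<and>
     tour_at t s \<and> clocks_upto t (mem s)"

lemma tour_next_child:
  assumes "Suc t < 2 * n" and "tour ! t = (v, False)" and "buckets M HD NX n n (children_upto n)" and "v < n"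
  shows "tour ! Suc t = (if M (HD + v) = 0 then (v, True) else (M (HD + v) - 1, False))"
  using tour_succ[OF assms(1)] assms(2) buckets_head(1)[OF assms(3,4)] by (auto simp: tour_step_def)

text \<open>\<open>tour_step\<close> leaves open whose child list is continued. Parents are unique,
  so it can only be that of \<open>par ! v\<close>, and the link of \<open>v\<close> tells whether
  \<open>v\<close> is its last member.\<close>

lemma tour_next_sibling:
  assumes "Suc t < 2 * n" and "tour ! t = (v, True)" and "buckets M HD NX n n (children_upto n)"
  shows "tour ! Suc t = (if M (NX + v) = 0 then (par ! v, True) else (M (NX + v) - 1, False))"
proof -
  obtain p as bs where p: "children_upto n p = as @ v # bs"
    "tour ! Suc t = (if bs = [] then (p, True) else (hd bs, False))"
    using tour_succ[OF assms(1)] assms(2) by (auto simp: tour_step_def)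
  then have "v \<in> set (children_upto n p)" by simp
  then have "(p, v) \<in> T" "par ! v = p" using set_children by (auto simp: children_upto_def)
  then have "p < n" using dfs_facts(2) by auto
  then show ?thesis using buckets_next(1)[OF assms(3) _ p(1)] p(2) \<open>par ! v = p\<close> by auto
qed

lemma clocks_upto_Suc:
  assumes "clocks_upto t M" and "t < 2 * n" and "tour ! t = (v, f)" and "v < n"
  shows "clocks_upto (Suc t) (M((if f then OUT else IN) + v := t))"
proof -
  have v: "clock (v, f) = t" using clock_nth assms(2,3) by metis
  have "clock (w, g) < t" if "w < n" "clock (w, g) < Suc t" "(w, g) \<noteq> (v, f)" for w g
    using that clock(2)[of w g] assms(3) by (metis less_SucE)
  moreover have "IN + n \<le> OUT" by (rule layout)
  ultimately show ?thesis using assms(1,4) v unfolding clocks_upto_def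
    by (cases f) auto
qed

lemma runs_walk_tour:
  assumes "inv_children n s'" "s = s'\<lparr>reg := (reg s')(3 := 0, 5 := 0)\<rparr>"
  shows "runs W walk_tour (n * 200 + 100) (inv_tour (2 * n)) s"
proof -
  let ?b = "Reg 3 \<prec> Const 2 \<otimes> Reg 0"
  let ?p = "Cond (Reg 5)
        (Store (Reg 14 \<oplus> Reg 4) (Reg 3) ;; Assign 6 (Load (Reg 12 \<oplus> Reg 4)) ;;
         Cond (Reg 6) (Assign 4 (Reg 6 \<ominus> Const 1) ;; Assign 5 (Const 0)) (Assign 4 (Load (Reg 10 \<oplus> Reg 4))))
        (Store (Reg 13 \<oplus> Reg 4) (Reg 3) ;; Assign 6 (Load (Reg 11 \<oplus> Reg 4)) ;;
         Cond (Reg 6) (Assign 4 (Reg 6 \<ominus> Const 1)) (Assign 5 (Const 1))) ;;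
      Assign 3 (Reg 3 \<oplus> Const 1)"
  have "runs W (While ?b ?p) (2 * n * (cost ?b + 1 + max_time ?p) + cost ?b + 1) (inv_tour (2 * n)) s"
  proof (rule runs_for[where J = inv_tour])
    show "inv_tour 0 s" using assms r_less tour_hd
      by (simp add: inv_tour_def inv_children_def env_def tour_at_def clocks_upto_def)
  next
    fix t s assume "inv_tour t s" "t \<le> 2 * n"
    then have "reg s 3 = t" "reg s 0 = n" by (simp_all add: inv_tour_def env_def)
    then show "fits W s ?b \<and> (val s ?b \<noteq> 0) = (t < 2 * n)" using \<open>t \<le> 2 * n\<close> W_bounds(1) by simp
  next
    fix t s assume I: "inv_tour t s" and t: "t < 2 * n"
    define v where "v = reg s 4"
    have f: "env s" "reg s 3 = t" "edges (mem s)" "arr (mem s) PAR n ((!) par)"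
     "buckets (mem s) HD NX n n (children_upto n)" "\<forall>v<n. mem s (NX + v) \<le> n" "\<forall>a\<ge>AA. mem s a = 0"
     "clocks_upto t (mem s)" "reg s 5 \<le> 1" and v: "v < n" "tour ! t = (v, reg s 5 \<noteq> 0)"
      using I t by (auto simp: inv_tour_def tour_at_def v_def)
    note [simp] = v_def[symmetric]
    have pv: "mem s (PAR + v) = par ! v" "par ! v < n"
      using arr_lookup[OF f(4) v(1)] par_less[OF v(1)] by auto
    have le: "mem s (NX + v) \<le> n" "mem s (HD + v) \<le> n" using f(6) v buckets_head(2)[OF f(5) v(1)] by auto
    show "wp W ?p (inv_tour (Suc t)) s"
    proof (cases "reg s 5 = 0")
      case True
      let ?M = "(mem s)(IN + v := t)"
      have M: "edges ?M" "arr ?M PAR n ((!) par)" "buckets ?M HD NX n n (children_upto n)"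
        "\<forall>v<n. ?M (NX + v) \<le> n" "\<forall>a\<ge>AA. ?M a = 0" "clocks_upto (Suc t) ?M" "?M (HD + v) = mem s (HD + v)"
        using f v layout clocks_upto_Suc[OF f(8) t v(2,1)] True
        by (simp_all add: edges_other arr_other buckets_other)
      have su: "tour ! Suc t = (if mem s (HD + v) = 0 then (v, True) else (mem s (HD + v) - 1, False))"
        if "Suc t < 2 * n"
        using tour_next_child[OF that _ f(5) v(1)] v(2) True by simp
      have small: "IN + v < W" "HD + v < W" "t + 1 < W" "IN < W" "HD < W" "mem s (HD + v) < W" "v < W" "1 < W"
        using layout t v(1) le by simp_all
      have regs: "reg s 11 = HD" "reg s 13 = IN" using f(1) by (simp_all add: env_def)
      have inv: "inv_tour (Suc t) s'"
        if "env s'" "reg s' 3 = Suc t" "mem s' = ?M" "reg s' 4 = (if mem s (HD + v) = 0 then v else mem s (HD + v) - 1)"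
          "reg s' 5 = (if mem s (HD + v) = 0 then 1 else 0)" for s'
        using that M su v(1) le by (auto simp: inv_tour_def tour_at_def simp del: fun_upd_apply)
      show ?thesis
        using f(2) small regs M(7) True f(1)
        by (cases "mem s (HD + v) = 0") (simp_all add: inv env_def)
    next
      case False
      let ?M = "(mem s)(OUT + v := t)"
      have M: "edges ?M" "arr ?M PAR n ((!) par)" "buckets ?M HD NX n n (children_upto n)"
        "\<forall>v<n. ?M (NX + v) \<le> n" "\<forall>a\<ge>AA. ?M a = 0" "clocks_upto (Suc t) ?M" "?M (NX + v) = mem s (NX + v)"
        "?M (PAR + v) = par ! v"
        using f v pv layout clocks_upto_Suc[OF f(8) t v(2,1)] False
        by (simp_all add: edges_other arr_other buckets_other)
      have su: "tour ! Suc t = (if mem s (NX + v) = 0 then (par ! v, True) else (mem s (NX + v) - 1, False))"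
        if "Suc t < 2 * n"
        using tour_next_sibling[OF that _ f(5)] v(2) False by simp
      have small: "OUT + v < W" "NX + v < W" "PAR + v < W" "t + 1 < W" "OUT < W" "NX < W" "PAR < W"
         "mem s (NX + v) < W" "v < W" "1 < W" "par ! v < W" "reg s 5 < W"
        using layout t v(1) le pv f(9) by simp_all
      have regs: "reg s 12 = NX" "reg s 14 = OUT" "reg s 10 = PAR" using f(1) by (simp_all add: env_def)
      have inv: "inv_tour (Suc t) s'"
        if "env s'" "reg s' 3 = Suc t" "mem s' = ?M" "reg s' 4 = (if mem s (NX + v) = 0 then par ! v else mem s (NX + v) - 1)"
          "reg s' 5 = (if mem s (NX + v) = 0 then reg s 5 else 0)" for s'
        using that M su pv le f(9) False by (auto simp: inv_tour_def tour_at_def simp del: fun_upd_apply)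
      show ?thesis
        using f(2) small regs M(7,8) False f(1)
        by (cases "mem s (NX + v) = 0") (simp_all add: inv env_def)
    qed
  qed
  then show ?thesis unfolding walk_tour_def
    by (rule runs_weaken) simp_all
qed

section \<open>Orienting the edges by entry time\<close>

definition anc :: "nat \<Rightarrow> nat" where
  "anc j = (if tin (fst (es ! j)) < tin (snd (es ! j)) then fst (es ! j) else snd (es ! j))"

definition desc :: "nat \<Rightarrow> nat" where
  "desc j = (if tin (fst (es ! j)) < tin (snd (es ! j)) then snd (es ! j) else fst (es ! j))"

text \<open>The ends of an edge are comparable in a DFS tree, and an ancestor is entered before its
  proper descendants, so comparing entry times identifies the upper end.\<close>

lemma anc_desc:
  assumes "j < m"
  shows "anc j < n" "desc j < n" "{anc j, desc j} \<in> E" "(anc j, desc j) \<in> T\<^sup>*"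
proof -
  let ?a = "fst (es ! j)" and ?c = "snd (es ! j)"
  have e: "{?a, ?c} \<in> E" by (rule edge_list(5)[OF assms])
  then have lt: "?a < n" "?c < n" using edge_bounds by auto
  then show "anc j < n" "desc j < n" by (auto simp: anc_def desc_def)
  show "{anc j, desc j} \<in> E" using e by (auto simp: anc_def desc_def insert_commute)
  obtain a c where ac: "es ! j = (a, c)" by (cases "es ! j")
  with e lt dfs_props(9)[of a c] have "(a, c) \<in> T\<^sup>* \<or> (c, a) \<in> T\<^sup>*" "a < n" "c < n" by auto
  then show "(anc j, desc j) \<in> T\<^sup>*"
    unfolding anc_def desc_def ac by (auto simp: ancestor_iff dest: tin_inj)
qed

lemma E_eq: "E = (\<lambda>j. {desc j, anc j}) ` {..<m}"
  unfolding edge_list(6) by (rule image_cong) (auto simp: anc_def desc_def)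

definition tables :: "(nat \<Rightarrow> nat) \<Rightarrow> bool" where
  "tables M \<longleftrightarrow> arr M IN n tin \<and> arr M OUT n tout"

lemma tables_other: "tables M \<Longrightarrow> a < IN \<or> AA \<le> a \<Longrightarrow> tables (M(a := x))"
  using layout by (auto simp: tables_def intro!: arr_other)

lemma tables_lookup:
  "tables M \<Longrightarrow> v < n \<Longrightarrow> M (IN + v) = tin v" "tables M \<Longrightarrow> v < n \<Longrightarrow> M (OUT + v) = tout v"
  by (auto simp: tables_def dest: arr_lookup)

definition by_anc :: "nat \<Rightarrow> nat \<Rightarrow> nat list" where
  "by_anc i k = filter (\<lambda>j. tin (anc j) = k) (rev [0..<i])"

definition inv_orient :: "nat \<Rightarrow> state \<Rightarrow> bool" where
  "inv_orient i s \<longleftrightarrow> env s \<and> reg s 3 = i \<and> edges (mem s) \<and> tables (mem s) \<and>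
     arr (mem s) AA i anc \<and> arr (mem s) DD i desc \<and>
     buckets (mem s) H1 N1 (2 * n) m (by_anc i) \<and> (\<forall>a\<ge>H2. mem s a = 0)"

lemma runs_orient_edges:
  assumes "inv_tour (2 * n) s'" "s = s'\<lparr>reg := (reg s')(3 := 0)\<rparr>"
  shows "runs W orient_edges (m * 200 + 100) (inv_orient m) s"
proof -
  let ?b = "Reg 3 \<prec> Reg 1"
  let ?q = "Assign 6 (Load (Const 2 \<oplus> Const 2 \<otimes> Reg 3)) ;; Assign 7 (Load (Const 3 \<oplus> Const 2 \<otimes> Reg 3)) ;;
      Cond (Load (Reg 13 \<oplus> Reg 6) \<prec> Load (Reg 13 \<oplus> Reg 7)) Skip
        (Assign 8 (Reg 6) ;; Assign 6 (Reg 7) ;; Assign 7 (Reg 8))"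
  let ?r = "Store (Reg 15 \<oplus> Reg 3) (Reg 6) ;; Store (Reg 16 \<oplus> Reg 3) (Reg 7) ;;
      Assign 8 (Load (Reg 13 \<oplus> Reg 6)) ;; push 17 18 8 3 ;;
      Assign 3 (Reg 3 \<oplus> Const 1)"
  let ?p = "Assign 6 (Load (Const 2 \<oplus> Const 2 \<otimes> Reg 3)) ;; Assign 7 (Load (Const 3 \<oplus> Const 2 \<otimes> Reg 3)) ;;
      Cond (Load (Reg 13 \<oplus> Reg 6) \<prec> Load (Reg 13 \<oplus> Reg 7)) Skip
        (Assign 8 (Reg 6) ;; Assign 6 (Reg 7) ;; Assign 7 (Reg 8)) ;;
      Store (Reg 15 \<oplus> Reg 3) (Reg 6) ;; Store (Reg 16 \<oplus> Reg 3) (Reg 7) ;;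
      Assign 8 (Load (Reg 13 \<oplus> Reg 6)) ;; push 17 18 8 3 ;;
      Assign 3 (Reg 3 \<oplus> Const 1)"
  have "runs W (While ?b ?p) (m * (cost ?b + 1 + max_time ?p) + cost ?b + 1) (inv_orient m) s"
  proof (rule runs_for[where J = inv_orient])
    have "tables (mem s)"
      using assms clock(1) by (auto simp: inv_tour_def clocks_upto_def tables_def arr_def)
    moreover have "buckets (mem s) H1 N1 (2 * n) m (by_anc 0)"
      using assms layout by (auto simp: inv_tour_def buckets_def by_anc_def)
    ultimately show "inv_orient 0 s"
      using assms layout by (auto simp: inv_tour_def inv_orient_def env_def arr_def)
  next
    fix i s assume "inv_orient i s" "i \<le> m"
    then have "reg s 3 = i" "reg s 1 = m" by (simp_all add: inv_orient_def env_def)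
    then show "fits W s ?b \<and> (val s ?b \<noteq> 0) = (i < m)" using \<open>i \<le> m\<close> W_bounds(1) by simp
  next
    fix i s assume I: "inv_orient i s" and i: "i < m"
    have f: "env s" "reg s 3 = i" "edges (mem s)" "tables (mem s)" "arr (mem s) AA i anc" "arr (mem s) DD i desc"
     "buckets (mem s) H1 N1 (2 * n) m (by_anc i)" "\<forall>a\<ge>H2. mem s a = 0"
      using I by (auto simp: inv_orient_def)
    let ?a = "fst (es ! i)" and ?c = "snd (es ! i)"
    have e: "mem s (2 + 2 * i) = ?a" "mem s (3 + 2 * i) = ?c" using f(3) i by (auto simp: edges_def)
    have lt: "?a < n" "?c < n" using edge_bounds edge_list(5)[OF i] by auto
    have tab: "mem s (IN + ?a) = tin ?a" "mem s (IN + ?c) = tin ?c" using tables_lookup(1)[OF f(4)] lt by auto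
    have tlt: "tin ?a < 2 * n" "tin ?c < 2 * n" using clock(1) lt by auto
    define k where "k = tin (anc i)"
    have k: "k < 2 * n" using anc_desc(1)[OF i] clock by (simp add: k_def)
    let ?M = "(mem s)(AA + i := anc i, DD + i := desc i)"
    let ?M' = "?M(N1 + i := mem s (H1 + k), H1 + k := Suc i)"
    have ne: "H1 + k \<noteq> AA + i" "H1 + k \<noteq> DD + i" "IN + anc i \<noteq> AA + i" "IN + anc i \<noteq> DD + i"
      using i k layout anc_desc(1)[OF i] by simp_all
    have bM: "buckets ?M H1 N1 (2 * n) m (by_anc i)" using f(7) i layout by (simp add: buckets_other)
    have "by_anc (Suc i) = (by_anc i)(k := i # by_anc i k)"
      by (rule ext) (auto simp: by_anc_def k_def)
    moreover have "buckets (?M(N1 + i := ?M (H1 + k), H1 + k := Suc i)) H1 N1 (2 * n) m ((by_anc i)(k := i # by_anc i k))"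
      by (rule buckets_push[OF bM k i]) (use layout in \<open>auto simp: by_anc_def\<close>)
    ultimately have bu: "buckets ?M' H1 N1 (2 * n) m (by_anc (Suc i))" using ne by simp
    have hd: "mem s (H1 + k) \<le> m" using buckets_head(2)[OF f(7) k] .
    have "arr ?M' AA (Suc i) anc" "arr ?M' DD (Suc i) desc"
      using f(5,6) i k layout unfolding arr_def by (auto simp: less_Suc_eq)
    moreover have "edges ?M'" "tables ?M'" "\<forall>a\<ge>H2. ?M' a = 0"
      using f i k layout by (simp_all add: edges_other tables_other)
    ultimately have inv: "inv_orient (Suc i) s'"
      if "env s'" "reg s' 3 = Suc i" "mem s' = ?M'" for s'
      using bu that unfolding inv_orient_def by (simp del: fun_upd_apply)
    have mk: "mem s (IN + anc i) = k"
      using anc_desc(1)[OF i] tables_lookup(1)[OF f(4)] by (simp add: k_def)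
    have lt': "anc i < n" "desc i < n" using anc_desc[OF i] by auto
    have small: "3 + 2 * i < W" "IN + ?a < W" "IN + ?c < W" "AA + i < W" "DD + i < W" "N1 + i < W" "H1 + k < W"
       "IN < W" "AA < W" "DD < W" "N1 < W" "H1 < W" "?a < W" "?c < W" "tin ?a < W" "tin ?c < W" "k < W" "2 + 2 * i < W"
       "IN + anc i < W" "anc i < W" "desc i < W" "i + 1 < W" "m < W" "3 < W"
      using layout i k lt lt' tlt by simp_all
    have regs: "reg s 1 = m" "reg s 13 = IN" "reg s 15 = AA" "reg s 16 = DD" "reg s 17 = H1" "reg s 18 = N1"
      using f(1) by (simp_all add: env_def)
    define R where "R s' \<longleftrightarrow> env s' \<and> reg s' 3 = i \<and> reg s' 6 = anc i \<and> reg s' 7 = desc i \<and> mem s' = mem s" for s'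
    have "wp W ?q R s"
      using f(2) regs small e tab f(1) by (auto simp: R_def env_def anc_def desc_def)
    then have "wp W ?q (wp W ?r (inv_orient (Suc i))) s"
    proof (rule wp_mono)
      fix s' assume "R s'"
      then have s': "reg s' 3 = i" "reg s' 6 = anc i" "reg s' 7 = desc i" "mem s' = mem s" "env s'"
        and regs': "reg s' 13 = IN" "reg s' 15 = AA" "reg s' 16 = DD" "reg s' 17 = H1" "reg s' 18 = N1"
        by (simp_all add: R_def env_def)
      show "wp W ?r (inv_orient (Suc i)) s'"
        using s'(1-4) regs' small ne mk hd s'(5) by (simp add: push_def inv env_def)
    qed
    then show "wp W ?p (inv_orient (Suc i)) s" by (simp only: wp_Seq)
  qed
  then show ?thesis unfolding orient_edges_def
    by (rule runs_weaken) (simp_all add: push_def)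
qed

section \<open>Sorting the edges and writing the words\<close>

definition by_desc :: "nat list \<Rightarrow> nat \<Rightarrow> nat list" where
  "by_desc seq k = filter (\<lambda>j. tin (desc j) = k) (rev seq)"

definition inv_sort :: "nat list \<Rightarrow> state \<Rightarrow> bool" where
  "inv_sort seq s \<longleftrightarrow> env s \<and> tables (mem s) \<and>
     arr (mem s) AA m anc \<and> arr (mem s) DD m desc \<and>
     buckets (mem s) H2 N2 (2 * n) m (by_desc seq)"

text \<open>Pushing reverses each bucket, hence both occurrences of \<open>rev\<close>. The first
  pass yields increasing entry times of the upper ends; the reversal in the second pass turns them
  into decreasing ones among edges with the same lower end, so that these come deepest
  first.\<close>

definition "sorted_by_anc = bucket_sort (\<lambda>j. tin (anc j)) (2 * n) (rev [0..<m])"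
definition "sorted_edges = bucket_sort (\<lambda>j. tin (desc j)) (2 * n) (rev sorted_by_anc)"

lemma sorted_by_anc: "set sorted_by_anc = {..<m}" "distinct sorted_by_anc" "length sorted_by_anc = m"
proof -
  show 1: "set sorted_by_anc = {..<m}" unfolding sorted_by_anc_def
    by (subst set_bucket_sort) (use anc_desc clock in auto)
  show 2: "distinct sorted_by_anc" unfolding sorted_by_anc_def by (rule distinct_bucket_sort) simp
  show "length sorted_by_anc = m" using distinct_card[OF 2] 1 by simp
qed

lemma sorted_edges: "set sorted_edges = {..<m}" "distinct sorted_edges" "length sorted_edges = m"
proof -
  show 1: "set sorted_edges = {..<m}" unfolding sorted_edges_def
    by (subst set_bucket_sort) (use sorted_by_anc anc_desc clock in auto)
  show 2: "distinct sorted_edges" unfolding sorted_edges_def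
    by (rule distinct_bucket_sort) (simp add: sorted_by_anc)
  show "length sorted_edges = m" using distinct_card[OF 2] 1 by simp
qed

lemma sorted_edges_order:
  assumes "i < j" "j < m"
  shows "tin (desc (sorted_edges ! i)) < tin (desc (sorted_edges ! j)) \<or>
    tin (desc (sorted_edges ! i)) = tin (desc (sorted_edges ! j)) \<and>
    tin (anc (sorted_edges ! j)) \<le> tin (anc (sorted_edges ! i))"
proof -
  have "sorted_wrt (\<lambda>x y. True) (rev [0..<m])" by (simp add: sorted_wrt_iff_nth_less)
  then have "sorted_wrt (\<lambda>x y. tin (anc x) < tin (anc y) \<or> tin (anc x) = tin (anc y) \<and> True) sorted_by_anc"
    unfolding sorted_by_anc_def by (rule sorted_wrt_bucket_sort)
  then have "sorted_wrt (\<lambda>x y. tin (anc y) \<le> tin (anc x)) (rev sorted_by_anc)"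
    unfolding sorted_wrt_rev by (rule sorted_wrt_mono_rel[rotated]) auto
  then have "sorted_wrt (\<lambda>x y. tin (desc x) < tin (desc y) \<or>
      tin (desc x) = tin (desc y) \<and> tin (anc y) \<le> tin (anc x)) sorted_edges"
    unfolding sorted_edges_def by (rule sorted_wrt_bucket_sort)
  then show ?thesis using assms by (simp add: sorted_wrt_iff_nth_less sorted_edges(3))
qed

lemma runs_sort_edges:
  assumes "inv_orient m s'" "s = s'\<lparr>reg := (reg s')(3 := 0)\<rparr>"
  shows "runs W sort_edges ((2 * n + m) * 100 + 20) (inv_sort sorted_by_anc) s"
proof -
  have f: "env s" "reg s 3 = 0" "tables (mem s)" "arr (mem s) AA m anc" "arr (mem s) DD m desc"
    "buckets (mem s) H1 N1 (2 * n) m (by_anc m)" "\<forall>a\<ge>H2. mem s a = 0"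
    using assms by (auto simp: inv_orient_def env_def)
  have all: "concat (map (by_anc m) [0..<2 * n]) = sorted_by_anc"
    by (simp add: sorted_by_anc_def bucket_sort_def by_anc_def[abs_def])
  let ?p = "Assign 8 (Load (Reg 13 \<oplus> Load (Reg 16 \<oplus> Reg 7))) ;; push 19 20 8 7"
  have "runs W (drain 17 18 ?p) ((2 * n + length (concat (map (by_anc m) [0..<2 * n]))) * (30 + max_time ?p) + 20)
    (\<lambda>s. inv_sort (concat (map (by_anc m) [0..<2 * n])) s) s"
  proof (rule runs_drain[OF f(2,6)])
    show "inv_sort [] s" using f layout by (auto simp: inv_sort_def buckets_def by_desc_def)
  next
    fix seq s assume "inv_sort seq s"
    then show "2 * reg s 0 = 2 * n \<and> reg s 17 = H1 \<and> reg s 18 = N1"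
      by (simp add: inv_sort_def env_def)
  next
    fix seq s and i :: nat and x assume "inv_sort seq s" "i \<in> {3, 6, 7}"
    then show "inv_sort seq (s\<lparr>reg := (reg s)(i := x)\<rparr>)"
      by (auto simp: inv_sort_def env_def)
  next
    fix seq s k x assume I: "inv_sort seq s" "k < 2 * n"
    have "tables ((mem s)(H1 + k := x))" "buckets ((mem s)(H1 + k := x)) H2 N2 (2 * n) m (by_desc seq)"
      "arr ((mem s)(H1 + k := x)) AA m anc" "arr ((mem s)(H1 + k := x)) DD m desc"
      using I layout by (auto simp: inv_sort_def intro!: tables_other arr_other buckets_other)
    then show "inv_sort seq (s\<lparr>mem := (mem s)(H1 + k := x)\<rparr>)"
      using I by (simp add: inv_sort_def env_mem)
  next
    fix seq x s b'
    assume I: "inv_sort seq s" "reg s 7 = x" "x < m" "seq @ x # concat b' = concat (map (by_anc m) [0..<2 * n])"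
    have f: "env s" "tables (mem s)" "arr (mem s) AA m anc" "arr (mem s) DD m desc"
      "buckets (mem s) H2 N2 (2 * n) m (by_desc seq)"
      using I(1) by (auto simp: inv_sort_def)
    \<comment> \<open>The buckets of the second pass contain only members of \<open>seq\<close>.
      Since the drained sequence is distinct, \<open>x\<close> is new to them, as
      \<open>buckets_push\<close> requires.\<close>
    have x: "x \<notin> set seq" using sorted_by_anc(2) I(4) all by (metis distinct_append disjoint_iff list.set_intros(1))
    define k where "k = tin (desc x)"
    have k: "k < 2 * n" using anc_desc(2)[OF I(3)] clock by (simp add: k_def)
    have ld: "mem s (DD + x) = desc x" "mem s (IN + desc x) = k" "desc x < n"
      using arr_lookup[OF f(4) I(3)] tables_lookup(1)[OF f(2)] anc_desc(2)[OF I(3)] by (auto simp: k_def)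
    let ?M = "(mem s)(N2 + x := mem s (H2 + k), H2 + k := Suc x)"
    have "by_desc (seq @ [x]) = (by_desc seq)(k := x # by_desc seq k)"
      by (rule ext) (auto simp: by_desc_def k_def)
    moreover have "buckets ?M H2 N2 (2 * n) m ((by_desc seq)(k := x # by_desc seq k))"
      by (rule buckets_push[OF f(5) k I(3)]) (use layout x in \<open>auto simp: by_desc_def\<close>)
    ultimately have bu: "buckets ?M H2 N2 (2 * n) m (by_desc (seq @ [x]))" by simp
    have "tables ?M" "arr ?M AA m anc" "arr ?M DD m desc"
      using f layout by (auto intro!: tables_other arr_other)
    moreover have "\<forall>a\<in>{H1..<H1 + 2 * n} \<union> {N1..<N1 + m}. ?M a = mem s a" using layout by auto
    moreover have "mem s (H2 + k) \<le> m" using buckets_head(2)[OF f(5) k] .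
    ultimately show "wp W ?p (\<lambda>s'. inv_sort (seq @ [x]) s' \<and> reg s' 3 = reg s 3 \<and>
          (\<forall>a\<in>{H1..<H1 + 2 * n} \<union> {N1..<N1 + m}. mem s' a = mem s a)) s"
      using f(1) bu ld I(2,3) k layout by (simp add: inv_sort_def env_def push_def)
  qed (use layout in simp_all)
  then show ?thesis unfolding all sort_edges_def
    by (rule runs_weaken) (simp_all add: push_def sorted_by_anc)
qed

text \<open>The fifth field of word \<open>v - 1\<close> is the entry time of vertex \<open>v > 0\<close>; that of vertex \<open>0\<close> is
  repeated in every word, since for a tree there is no word left for it.\<close>

definition fields :: "nat \<Rightarrow> nat list" where
  "fields i = (let j = sorted_edges ! i in
     [tin (desc j), tin (anc j), tout (anc j), anc j, tin (Suc i mod n), tin 0, m])"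

definition structure_words :: "nat list" where
  "structure_words = map (\<lambda>i. pack b (fields i)) [0..<m]"

lemma fields_less: "i < m \<Longrightarrow> \<forall>f\<in>set (fields i). f < b * b"
proof -
  assume i: "i < m"
  let ?j = "sorted_edges ! i"
  have "?j < m" using sorted_edges i by (metis lessThan_iff nth_mem)
  note a = anc_desc(1,2)[OF this]
  have c: "clock (v, g) < b * b" if "v < n" for v g using clock(1)[OF that, of g] W_bounds(4) by simp
  have "anc ?j < b * b" using a(1) W_bounds(4) by simp
  moreover have "Suc i mod n < n" "0 < n" using r_less by auto
  ultimately show ?thesis using a W_bounds(3) by (auto simp: fields_def Let_def intro!: c)
qed

lemma structure_words_less: "\<forall>w\<in>set structure_words. w < W"
proof -
  have "pack b (fields i) < W" if "i < m" for i
    using pack_less[OF b_bounds(3) fields_less[OF that]] W_bounds(2)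
    by (simp add: fields_def Let_def eval_nat_numeral)
  then show ?thesis by (auto simp: structure_words_def)
qed

definition inv_write :: "nat list \<Rightarrow> state \<Rightarrow> bool" where
  "inv_write seq s \<longleftrightarrow> env s \<and> tables (mem s) \<and> arr (mem s) AA m anc \<and> arr (mem s) DD m desc \<and>
     reg s 9 = length seq \<and> length seq \<le> m \<and> (\<forall>i<length seq. mem s i = pack b (fields i))"

lemma runs_write_words:
  assumes "inv_sort sorted_by_anc s'" "s = s'\<lparr>reg := (reg s')(3 := 0, 9 := 0)\<rparr>"
  shows "runs W write_words ((2 * n + m) * 200 + 20) (inv_write sorted_edges) s"
proof -
  have f: "env s" "reg s 3 = 0" "tables (mem s)" "arr (mem s) AA m anc" "arr (mem s) DD m desc"
    "buckets (mem s) H2 N2 (2 * n) m (by_desc sorted_by_anc)" "reg s 9 = 0"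
    using assms by (auto simp: inv_sort_def env_def)
  have all: "concat (map (by_desc sorted_by_anc) [0..<2 * n]) = sorted_edges"
    by (simp add: sorted_edges_def bucket_sort_def by_desc_def[abs_def])
  let ?p = "Store (Reg 9) word_exp ;; Assign 9 (Reg 9 \<oplus> Const 1)"
  have "runs W (drain 19 20 ?p) ((2 * n + length (concat (map (by_desc sorted_by_anc) [0..<2 * n]))) * (30 + max_time ?p) + 20)
    (\<lambda>s. inv_write (concat (map (by_desc sorted_by_anc) [0..<2 * n])) s) s"
  proof (rule runs_drain[OF f(2,6)])
    show "inv_write [] s" using f by (auto simp: inv_write_def)
  next
    fix seq s assume "inv_write seq s"
    then show "2 * reg s 0 = 2 * n \<and> reg s 19 = H2 \<and> reg s 20 = N2"
      by (simp add: inv_write_def env_def)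
  next
    fix seq s and i :: nat and x assume "inv_write seq s" "i \<in> {3, 6, 7}"
    then show "inv_write seq (s\<lparr>reg := (reg s)(i := x)\<rparr>)"
      by (auto simp: inv_write_def env_def)
  next
    fix seq s k x assume I: "inv_write seq s" "k < 2 * n"
    have "tables ((mem s)(H2 + k := x))"
      "arr ((mem s)(H2 + k := x)) AA m anc" "arr ((mem s)(H2 + k := x)) DD m desc"
      using I layout by (auto simp: inv_write_def intro!: tables_other arr_other)
    then show "inv_write seq (s\<lparr>mem := (mem s)(H2 + k := x)\<rparr>)"
      using I layout by (simp add: inv_write_def env_mem)
  next
    fix seq x s b'
    assume I: "inv_write seq s" "reg s 7 = x" "x < m"
      "seq @ x # concat b' = concat (map (by_desc sorted_by_anc) [0..<2 * n])"
    have f: "env s" "tables (mem s)" "arr (mem s) AA m anc" "arr (mem s) DD m desc"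
      "reg s 9 = length seq" "\<forall>i<length seq. mem s i = pack b (fields i)"
      using I(1) by (auto simp: inv_write_def)
    \<comment> \<open>The number of words written so far is also the position of the drained edge
      \<open>x\<close> in the sorted order.\<close>
    define i where "i = length seq"
    have "length (seq @ x # concat b') = m" using I(4) all sorted_edges(3) by simp
    then have i: "i < m" by (simp add: i_def)
    have x: "x = sorted_edges ! i" using I(4) all by (metis i_def nth_append_length)
    have ad: "anc x < n" "desc x < n" using anc_desc[OF I(3)] by auto
    have ld: "mem s (DD + x) = desc x" "mem s (AA + x) = anc x"
      using arr_lookup[OF f(4) I(3)] arr_lookup[OF f(3) I(3)] by auto
    have tl: "mem s (IN + v) = tin v" "mem s (OUT + v) = tout v" "tin v < 2 * n" "tout v < 2 * n" if "v < n" for v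
      using tables_lookup[OF f(2) that] clock(1)[OF that] by auto
    have sm: "Suc i mod n < n" "0 < n" using r_less by auto
    let ?es = "[Load (Reg 13 \<oplus> Load (Reg 16 \<oplus> Reg 7)), Load (Reg 13 \<oplus> Load (Reg 15 \<oplus> Reg 7)),
      Load (Reg 14 \<oplus> Load (Reg 15 \<oplus> Reg 7)), Load (Reg 15 \<oplus> Reg 7),
      Load (Reg 13 \<oplus> Bin Mod (Reg 9 \<oplus> Const 1) (Reg 0)), Load (Reg 13), Reg 1]"
    have vals: "map (val s) ?es = fields i"
      using f(1,5) I(2) ld tl[OF ad(1)] tl[OF ad(2)] tl[OF sm(1)] tl[OF sm(2)] x
      by (simp add: fields_def Let_def env_def i_def)
    have small: "Suc i < W" "n < W" "m < W" "AA < W" "DD < W" "IN < W" "OUT < W" "IN + Suc i mod n < W"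
      "Suc i mod n < W" "x < W" "DD + x < W" "AA + x < W" "anc x < W" "desc x < W" "IN + desc x < W" "IN + anc x < W"
      "OUT + anc x < W" "tin (desc x) < W" "tin (anc x) < W" "tout (anc x) < W" "tin (Suc i mod n) < W" "tin 0 < W"
      using I(3) tl(3,4)[OF ad(1)] tl(3,4)[OF ad(2)] tl(3)[OF sm(1)] tl(3)[OF sm(2)] ad sm(1) i layout
      by (linarith)+
    have fits: "\<forall>e\<in>set ?es. fits W s e"
      using f(1,5) I(2) ld tl(1,2)[OF ad(1)] tl(1,2)[OF ad(2)] tl(1)[OF sm(1)] tl(1)[OF sm(2)] small
      by (simp add: env_def i_def)
    have pk: "pack b (fields i) < W"
      using structure_words_less i by (simp add: structure_words_def)
    have bb: "b < W" "2 * b < W" "b * b < W"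
      by (rule radix_less)+
    have hw: "2 * b * horner (b * b) (fields i) < W" using pk by (simp add: pack_def)
    have "horner (b * b) (fields i) \<le> 2 * b * horner (b * b) (fields i)" using b_bounds(3) by simp
    then have hw': "horner (b * b) (fields i) < W" using hw by (rule le_less_trans)
    have "fits W s (horner_exp (Reg 21) ?es)"
    proof (rule fits_horner_exp[OF _ _ fits])
      show "fits W s (Reg 21)" "0 < val s (Reg 21)" using f(1) bb b_bounds(3) by (simp_all add: env_def)
      then show "horner (val s (Reg 21)) (map (val s) ?es) < W" unfolding vals using f(1) hw' by (simp add: env_def)
    qed
    moreover have "val s (horner_exp (Reg 21) ?es) = horner (b * b) (fields i)"
      unfolding val_horner_exp vals using f(1) by (simp add: env_def)
    moreover have "reg s 2 = b" "2 < W" using f(1) layout r_less by (simp_all add: env_def)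
    ultimately have fw: "fits W s word_exp" and vw: "val s word_exp = pack b (fields i)"
      using bb pk hw unfolding word_exp_def by (simp_all only: fits.simps val.simps binop_val.simps pack_def)
    let ?M = "(mem s)(i := pack b (fields i))"
    have "tables ?M" "arr ?M AA m anc" "arr ?M DD m desc"
      using f i layout by (auto intro!: tables_other arr_other)
    moreover have "\<forall>a\<in>{H2..<H2 + 2 * n} \<union> {N2..<N2 + m}. ?M a = mem s a" using layout i by auto
    moreover have "\<forall>j<Suc i. ?M j = pack b (fields j)" using f(6) by (auto simp: i_def less_Suc_eq)
    ultimately show "wp W ?p (\<lambda>s'. inv_write (seq @ [x]) s' \<and> reg s' 3 = reg s 3 \<and>
          (\<forall>a\<in>{H2..<H2 + 2 * n} \<union> {N2..<N2 + m}. mem s' a = mem s a)) s"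
      using f(1,5) fw vw i layout by (simp add: inv_write_def env_def i_def[symmetric])
  qed (use layout in simp_all)
  then show ?thesis unfolding all write_words_def
    by (rule runs_weaken) (simp_all add: word_exp_def sorted_edges)
qed

lemma runs_Assign_0:
  assumes "P s"
  shows "runs W (Assign i (Const 0)) 2 (\<lambda>t. \<exists>s. P s \<and> t = s\<lparr>reg := (reg s)(i := 0)\<rparr>) s"
proof -
  have "wp W (Assign i (Const 0)) (\<lambda>t. \<exists>s. P s \<and> t = s\<lparr>reg := (reg s)(i := 0)\<rparr>) s"
    using assms radix_less(1) by auto
  then show ?thesis by (rule runs_weaken[OF wp_runs]) simp_all
qed

lemma runs_Assign_0_0:
  assumes "P s"
  shows "runs W (Assign i (Const 0) ;; Assign j (Const 0)) 4 (\<lambda>t. \<exists>s. P s \<and> t = s\<lparr>reg := (reg s)(i := 0, j := 0)\<rparr>) s"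
proof -
  have "wp W (Assign i (Const 0) ;; Assign j (Const 0)) (\<lambda>t. \<exists>s. P s \<and> t = s\<lparr>reg := (reg s)(i := 0, j := 0)\<rparr>) s"
    using assms radix_less(1) by auto
  then show ?thesis by (rule runs_weaken[OF wp_runs]) simp_all
qed

lemma build_correct:
  "\<exists>t s. exec W build_program input t s \<and> t \<le> 5000 * (n + m) \<and> holds structure_words (mem s)"
proof -
  have c: "runs W list_children (n * 100 + 100) (inv_children n) s" if "env s \<and> reg s 3 = 0 \<and> mem s = mem input" for s
    using runs_list_children that by blast
  have t: "runs W walk_tour (n * 200 + 100) (inv_tour (2 * n)) s"
    if "\<exists>s'. inv_children n s' \<and> s = s'\<lparr>reg := (reg s')(3 := 0, 5 := 0)\<rparr>" for s
    using runs_walk_tour that by blast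
  have o: "runs W orient_edges (m * 200 + 100) (inv_orient m) s"
    if "\<exists>s'. inv_tour (2 * n) s' \<and> s = s'\<lparr>reg := (reg s')(3 := 0)\<rparr>" for s
    using runs_orient_edges that by blast
  have so: "runs W sort_edges ((2 * n + m) * 100 + 20) (inv_sort sorted_by_anc) s"
    if "\<exists>s'. inv_orient m s' \<and> s = s'\<lparr>reg := (reg s')(3 := 0)\<rparr>" for s
    using runs_sort_edges that by blast
  have w: "runs W write_words ((2 * n + m) * 200 + 20) (inv_write sorted_edges) s"
    if "\<exists>s'. inv_sort sorted_by_anc s' \<and> s = s'\<lparr>reg := (reg s')(3 := 0, 9 := 0)\<rparr>" for s
    using runs_write_words that by blast
  obtain t s where ts: "exec W (compute_bases ;; compute_radix ;; Assign 21 (Reg 2 \<otimes> Reg 2)) input t s"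
    "t \<le> 100 * n + 200" "env s \<and> reg s 3 = 0 \<and> mem s = mem input"
    using runs_setup by (auto simp: runs_def)
  \<comment> \<open>Sequences nest to the right in \<open>build_program\<close>, so the set-up run
    is taken apart here and reassembled around the remaining phases.\<close>
  obtain t1 s1 t2 s2 t3 s3 where 1: "exec W compute_bases input t1 s1" "exec W compute_radix s1 t2 s2"
    "exec W (Assign 21 (Reg 2 \<otimes> Reg 2)) s2 t3 s" "t = t1 + (t2 + t3)"
    using ts(1) by (auto elim!: exec_cases(4))
  have "runs W (list_children ;;
     (Assign 3 (Const 0) ;; Assign 5 (Const 0)) ;; walk_tour ;; Assign 3 (Const 0) ;; orient_edges ;;
     Assign 3 (Const 0) ;; sort_edges ;; (Assign 3 (Const 0) ;; Assign 9 (Const 0)) ;; write_words)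
     (n * 100 + 100 + (4 + (n * 200 + 100 + (2 + (m * 200 + 100 + (2 + ((2 * n + m) * 100 + 20 +
       (4 + ((2 * n + m) * 200 + 20))))))))) (inv_write sorted_edges) s"
    by (intro runs_Seq[OF c[OF ts(3)]] runs_Seq[OF runs_Assign_0_0] runs_Seq[OF t] runs_Seq[OF runs_Assign_0]
      runs_Seq[OF o] runs_Seq[OF so] w)
  then obtain t' s' where 2: "exec W (list_children ;;
     (Assign 3 (Const 0) ;; Assign 5 (Const 0)) ;; walk_tour ;; Assign 3 (Const 0) ;; orient_edges ;;
     Assign 3 (Const 0) ;; sort_edges ;; (Assign 3 (Const 0) ;; Assign 9 (Const 0)) ;; write_words) s t' s'"
    "t' \<le> n * 100 + 100 + (4 + (n * 200 + 100 + (2 + (m * 200 + 100 + (2 + ((2 * n + m) * 100 + 20 +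
       (4 + ((2 * n + m) * 200 + 20))))))))" "inv_write sorted_edges s'"
    unfolding runs_def by (elim exE conjE)
  have "exec W build_program input (t1 + (t2 + (t3 + t'))) s'"
    unfolding build_program_def using 1 2(1) by (intro exec.Seq)
  \<comment> \<open>The phases add up to at most \<open>1000 * n + 500 * m + 552\<close>, and
    \<open>n \<ge> 1\<close> absorbs the constant.\<close>
  moreover have "t1 + (t2 + (t3 + t')) \<le> 5000 * (n + m)"
    using 1(4) 2(2) ts(2) r_less by simp
  moreover have "holds structure_words (mem s')"
    using 2(3) by (auto simp: inv_write_def holds_def structure_words_def sorted_edges)
  ultimately show ?thesis by blast
qed

end

section \<open>Queries\<close>

text \<open>With \<open>b * b\<close> in register 4 and \<open>2 * b\<close> in register 5 this is
  the divisor of \<open>unpack\<close>. The index \<open>j\<close> is part of the program text, so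
  extracting a field takes constant time.\<close>

fun shift_exp :: "nat \<Rightarrow> exp" where
  "shift_exp 0 = Reg 5"
| "shift_exp (Suc j) = shift_exp j \<otimes> Reg 4"

definition field_exp :: "exp \<Rightarrow> nat \<Rightarrow> exp" where
  "field_exp a j = Bin Mod (Bin Div (Load a) (shift_exp j)) (Reg 4)"

lemma val_shift_exp: "val s (shift_exp j) = reg s 5 * reg s 4 ^ j"
  by (induction j) auto

lemma fits_shift_exp:
  assumes "reg s 4 < W" "0 < reg s 4" "reg s 5 * reg s 4 ^ j < W"
  shows "fits W s (shift_exp j)"
  using assms(3)
proof (induction j)
  case (Suc j)
  have "reg s 5 * reg s 4 ^ j \<le> reg s 5 * reg s 4 ^ Suc j" using assms(2) by simp
  also have "\<dots> < W" by (rule Suc.prems)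
  finally show ?case using Suc assms(1) by (simp add: val_shift_exp mult_ac)
qed simp

lemma cost_field_exp: "cost (field_exp a j) = cost a + 2 * j + 5"
proof -
  have "cost (shift_exp j) = 2 * j + 1" by (induction j) auto
  then show ?thesis by (simp add: field_exp_def)
qed

definition find_radix :: com where
  "find_radix = While (Bin Mod (Load (Const 0)) (Const 2 \<otimes> Reg 3) \<doteq> Const 0) (Assign 3 (Const 2 \<otimes> Reg 3))"

definition read_clock :: "nat \<Rightarrow> nat \<Rightarrow> com" where
  "read_clock i j = Cond (Reg i) (Assign j (field_exp (Reg i \<ominus> Const 1) 4)) (Assign j (field_exp (Const 0) 5))"

text \<open>Registers 6, 10 and 11 receive the entry times of \<open>u\<close> and of the top and the bottom of the path,
  register 9 whether \<open>pe\<close> is the bottom, and registers 12 and 13 the search interval.\<close>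

definition read_clocks :: com where
  "read_clocks =
     Assign 4 (Reg 3 \<otimes> Reg 3) ;; Assign 5 (Const 2 \<otimes> Reg 3) ;;
     read_clock 0 6 ;; read_clock 1 7 ;; read_clock 2 8 ;; Assign 9 (Reg 7 \<prec> Reg 8) ;;
     Cond (Reg 9) (Assign 10 (Reg 7) ;; Assign 11 (Reg 8)) (Assign 10 (Reg 8) ;; Assign 11 (Reg 7)) ;;
     Assign 12 (Const 0) ;; Assign 13 (field_exp (Const 0) 6)"

text \<open>Truth values are 0 and 1. A truncated difference \<open>1 - (x + y)\<close> negates a
  disjunction even when both disjuncts hold; a sum is a disjunction and a product a
  conjunction.\<close>

definition search :: com where
  "search = While (Reg 12 \<prec> Reg 13)
     (Assign 14 (Bin Div (Reg 12 \<oplus> Reg 13) (Const 2)) ;;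
      Assign 15 (field_exp (Reg 14) 0) ;; Assign 16 (field_exp (Reg 14) 1) ;; Assign 17 (field_exp (Reg 14) 2) ;;
      Cond (Reg 9) (Assign 18 (Const 1 \<ominus> ((Reg 11 \<prec> Reg 16) \<oplus> (Reg 17 \<prec> Reg 11)))) (Assign 18 (Reg 16 \<prec> Reg 10)) ;;
      Cond ((Reg 6 \<prec> Reg 15) \<oplus> (Reg 6 \<doteq> Reg 15) \<otimes> Reg 18) (Assign 13 (Reg 14)) (Assign 12 (Reg 14 \<oplus> Const 1)))"

text \<open>The search only locates a cut, so the entry next to it still has to pass the full test
  for an edge into the path. Register 0 is written last because it holds \<open>u\<close> until
  then.\<close>

definition finish :: com where
  "finish =
     Cond (Reg 9) Skip (Assign 12 (Reg 12 \<ominus> Const 1)) ;;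
     Cond (Reg 12 \<prec> field_exp (Const 0) 6)
       (Assign 15 (field_exp (Reg 12) 0) ;; Assign 16 (field_exp (Reg 12) 1) ;; Assign 17 (field_exp (Reg 12) 2) ;;
        Assign 1 (Reg 0) ;; Assign 2 (field_exp (Reg 12) 3) ;;
        Assign 0 ((Reg 15 \<doteq> Reg 6) \<otimes> (Const 1 \<ominus> (Reg 16 \<prec> Reg 10)) \<otimes>
          (Const 1 \<ominus> (Reg 11 \<prec> Reg 16)) \<otimes> (Const 1 \<ominus> (Reg 17 \<prec> Reg 11))))
       (Assign 0 (Const 0))"

definition query_program :: com where
  "query_program = Assign 3 (Const 1) ;; find_radix ;; read_clocks ;; search ;; finish"

lemma find_eq_Some:
  assumes "sorted_wrt R ys" and "v \<in> set ys" and "P v" and "\<And>w. w \<in> set ys \<Longrightarrow> P w \<Longrightarrow> \<not> R w v"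
  shows "find P ys = Some v"
  using assms by (induction ys) auto

context dfs_run
begin

abbreviation "d i \<equiv> tin (desc (sorted_edges ! i))"
abbreviation "p i \<equiv> tin (anc (sorted_edges ! i))"
abbreviation "q i \<equiv> tout (anc (sorted_edges ! i))"

end

section \<open>Why the cut of the binary search yields the answer\<close>

locale dfs_query = dfs_run +
  fixes u ps pe :: nat and xs :: "nat list"
  assumes query: "is_query {..<n} T r u ps pe xs"
begin

definition down :: bool where "down \<longleftrightarrow> tin ps < tin pe"
definition top :: nat where "top = (if down then ps else pe)"
definition bot :: nat where "bot = (if down then pe else ps)"

lemma vertices: "u < n" "ps < n" "pe < n" "top < n" "bot < n"
  using query by (auto simp: is_query_def top_def bot_def)

text \<open>If \<open>ps = pe\<close>, then \<open>top\<close> and \<open>bot\<close> coincide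
  whatever \<open>down\<close> says; otherwise the ends are comparable and have distinct entry
  times, which reveal the ancestor.\<close>

lemma top_bot: "(top, bot) \<in> T\<^sup>*"
proof -
  have "(ps, pe) \<in> T\<^sup>* \<or> (pe, ps) \<in> T\<^sup>*" using query by (simp add: is_query_def)
  moreover have "top = bot" if "ps = pe" unfolding top_def bot_def using that by simp
  moreover have "tin ps \<noteq> tin pe" if "ps \<noteq> pe" using tin_inj[OF vertices(2,3)] that by metis
  ultimately consider "top = bot" | "tin ps < tin pe" "(ps, pe) \<in> T\<^sup>*" | "\<not> tin ps < tin pe" "(pe, ps) \<in> T\<^sup>*"
    unfolding ancestor_iff[OF vertices(2,3)] ancestor_iff[OF vertices(3,2)] by linarith
  then show ?thesis by cases (simp_all add: top_def bot_def down_def)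
qed

lemma path_props:
  "set xs = {x. (top, x) \<in> T\<^sup>* \<and> (x, bot) \<in> T\<^sup>*}"
  "sorted_wrt (\<lambda>x y. if down then (y, x) \<in> T\<^sup>+ else (x, y) \<in> T\<^sup>+) (rev xs)"
proof -
  have tp: "tree_path T ps xs pe" using query by (simp add: is_query_def)
  \<comment> \<open>\<open>ys\<close> is the path read from top to bottom, so that one argument
    about descending paths covers both orientations of the query.\<close>
  define ys where "ys = (if down then xs else rev xs)"
  have "successively (\<lambda>x y. (x, y) \<in> T \<or> (y, x) \<in> T) (rev xs)"
    unfolding successively_rev using tp by (auto simp: tree_path_def disj_commute)
  then have "tree_path T pe (rev xs) ps"
    using tp by (auto simp: tree_path_def hd_rev last_rev)
  then have ys: "tree_path T top ys bot" using tp by (simp add: ys_def top_def bot_def)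
  have succ: "successively (\<lambda>x y. (x, y) \<in> T) ys" by (rule tree_path_descending[OF ys top_bot])
  have "set ys = {x. (top, x) \<in> T\<^sup>* \<and> (x, bot) \<in> T\<^sup>*}"
    using chain_set[OF succ] ys by (auto simp: tree_path_def)
  then show "set xs = {x. (top, x) \<in> T\<^sup>* \<and> (x, bot) \<in> T\<^sup>*}" by (simp add: ys_def split: if_splits)
  show "sorted_wrt (\<lambda>x y. if down then (y, x) \<in> T\<^sup>+ else (x, y) \<in> T\<^sup>+) (rev xs)"
    using chain_sorted[OF succ] by (cases down) (simp_all add: ys_def sorted_wrt_rev)
qed

lemma top_u: "(top, u) \<in> T\<^sup>*"
  using query path_props(1) by (auto simp: is_query_def intro: rtrancl_trans)

lemma u_notin: "u \<notin> set xs"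
  using query by (simp add: is_query_def)

text \<open>For \<open>top\<close> a single comparison is enough, since \<open>top\<close> and the
  upper end of an edge of \<open>u\<close> are both ancestors of \<open>u\<close>. No such relation
  is known for \<open>bot\<close>, hence the two-sided test there, with the exit time taken from the
  edge.\<close>

definition good :: "nat \<Rightarrow> bool" where
  "good i \<longleftrightarrow> d i = tin u \<and> tin top \<le> p i \<and> p i \<le> tin bot \<and> tin bot \<le> q i"

text \<open>The monotone predicate of the binary search. Among the edges of \<open>u\<close>, which come deepest first,
  the answer is the first one satisfying it if \<open>pe\<close> is the bottom of the path, and the last one
  violating it if \<open>pe\<close> is the top.\<close>

definition pred :: "nat \<Rightarrow> bool" where
  "pred i \<longleftrightarrow> tin u < d i \<or> tin u = d i \<and> (if down then p i \<le> tin bot \<and> tin bot \<le> q i else p i < tin top)"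

lemma sorted_edges_less: "i < m \<Longrightarrow> sorted_edges ! i < m"
  using sorted_edges by (metis lessThan_iff nth_mem)

lemma tin_trancl: "(x, y) \<in> T\<^sup>+ \<Longrightarrow> y < n \<Longrightarrow> tin x < tin y"
proof -
  assume xy: "(x, y) \<in> T\<^sup>+" "y < n"
  then have "x < n" using anc_in_V by (auto dest: trancl_into_rtrancl)
  moreover have "x \<noteq> y" using xy acyc by (auto simp: acyclic_def)
  ultimately have "tin x \<noteq> tin y" "tin x \<le> tin y"
    using xy ancestor_iff[of x y] tin_inj[of x y] by (auto dest!: trancl_into_rtrancl)
  then show "tin x < tin y" by simp
qed

lemma descI: "i < m \<Longrightarrow> d i = tin u \<Longrightarrow> desc (sorted_edges ! i) = u"
  using anc_desc(2)[OF sorted_edges_less] tin_inj vertices(1) by blast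

lemma ancestors_of_u_chain:
  assumes "(x, u) \<in> T\<^sup>*" and "(y, u) \<in> T\<^sup>*" and "tin x \<le> tin y"
  shows "(x, y) \<in> T\<^sup>*"
proof -
  have xy: "x < n" "y < n" using assms anc_in_V vertices(1) by auto
  have "(x, y) \<in> T\<^sup>* \<or> (y, x) \<in> T\<^sup>*" by (rule linear[OF assms(1,2)])
  moreover have "x = y" if "(y, x) \<in> T\<^sup>*" using that assms(3) xy ancestor_iff[of y x] tin_inj[of x y] by simp
  ultimately show ?thesis by auto
qed

lemma good_path:
  assumes "i < m" and "good i"
  shows "anc (sorted_edges ! i) \<in> set xs" and "{u, anc (sorted_edges ! i)} \<in> E"
proof -
  let ?x = "anc (sorted_edges ! i)"
  have du: "desc (sorted_edges ! i) = u" using assms descI by (simp add: good_def)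
  note a = anc_desc[OF sorted_edges_less[OF assms(1)], unfolded du]
  show "{u, ?x} \<in> E" using a(3) by (simp add: insert_commute)
  have "(top, ?x) \<in> T\<^sup>*" using ancestors_of_u_chain[OF top_u a(4)] assms(2) by (simp add: good_def)
  moreover have "(?x, bot) \<in> T\<^sup>*" using assms(2) a(1) vertices by (simp add: good_def ancestor_iff)
  ultimately show "?x \<in> set xs" using path_props(1) by simp
qed

lemma path_good:
  assumes "x \<in> set xs" and "{u, x} \<in> E"
  obtains i where "i < m" "good i" "anc (sorted_edges ! i) = x"
proof -
  obtain j where j: "j < m" "{u, x} = {desc j, anc j}" using assms(2) unfolding E_eq by auto
  have x: "(top, x) \<in> T\<^sup>*" "(x, bot) \<in> T\<^sup>*" using assms(1) path_props(1) by auto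
  have "\<not> (u, x) \<in> T\<^sup>*" using x top_u u_notin path_props(1) by (auto intro: rtrancl_trans)
  then have ux: "desc j = u" "anc j = x" using j anc_desc(4)[OF j(1)] by (auto simp: doubleton_eq_iff)
  obtain i where i: "i < m" "sorted_edges ! i = j"
    using sorted_edges(1,3) j(1) by (metis in_set_conv_nth lessThan_iff)
  have "x < n" using anc_desc(1)[OF j(1)] ux by simp
  then have "good i" using x vertices i ux by (simp add: good_def ancestor_iff)
  then show thesis using that i ux by simp
qed

lemma entries_ordered:
  assumes "i < j" "j < m"
  shows "d i < d j \<or> d i = d j \<and> p j \<le> p i"
  using sorted_edges_order[OF assms] .

text \<open>Among the edges of \<open>u\<close>, a later upper end is an ancestor of an earlier one.
  Being above \<open>bot\<close>, or strictly above \<open>top\<close>, passes on to ancestors.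
  Edges with another lower end are separated by the entry time of that end.\<close>

lemma pred_mono:
  assumes "i < j" "j < m" "pred i"
  shows "pred j"
proof (cases "d i = tin u \<and> d j = tin u")
  case True
  then have le: "p j \<le> p i" using entries_ordered[OF assms(1,2)] by simp
  have i: "i < m" using assms by simp
  note ai = anc_desc[OF sorted_edges_less[OF i]] and aj = anc_desc[OF sorted_edges_less[OF assms(2)]]
  show ?thesis
  proof (cases down)
    case down: True
    have "(anc (sorted_edges ! j), anc (sorted_edges ! i)) \<in> T\<^sup>*"
      using ancestors_of_u_chain[OF _ _ le] ai(4) aj(4) descI[OF i] descI[OF assms(2)] True by metis
    moreover have "(anc (sorted_edges ! i), bot) \<in> T\<^sup>*"
      using assms(3) True down ai(1) vertices by (simp add: pred_def ancestor_iff)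
    ultimately have "(anc (sorted_edges ! j), bot) \<in> T\<^sup>*" by (rule rtrancl_trans)
    then show ?thesis using True down aj(1) vertices by (simp add: pred_def ancestor_iff)
  qed (use assms(3) True le in \<open>simp add: pred_def\<close>)
next
  case False
  then show ?thesis using entries_ordered[OF assms(1,2)] assms(3) by (auto simp: pred_def)
qed

definition cut :: "nat \<Rightarrow> bool" where
  "cut l \<longleftrightarrow> l \<le> m \<and> (\<forall>i<l. \<not> pred i) \<and> (\<forall>i. l \<le> i \<longrightarrow> i < m \<longrightarrow> pred i)"

text \<open>For \<open>l = 0\<close> and a path towards the top, truncated subtraction yields entry
  0. It satisfies \<open>pred\<close>, hence is not \<open>good\<close>, and the answer is correctly
  null.\<close>

definition candidate :: "nat \<Rightarrow> nat" where
  "candidate l = (if down then l else l - 1)"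

lemma candidate_best:
  assumes "cut l" and "i < m" and "good i"
  shows "candidate l < m" "good (candidate l)"
    "if down then p i \<le> p (candidate l) else p (candidate l) \<le> p i"
proof -
  let ?c = "candidate l"
  have *: "?c < m \<and> good ?c \<and> (if down then p i \<le> p ?c else p ?c \<le> p i)"
  proof (cases down)
    case True
    have "pred i" using assms(3) True by (simp add: good_def pred_def)
    then have li: "l \<le> i" using assms(1,2) by (auto simp: cut_def not_less[symmetric])
    then have l: "l < m" "pred l" using assms(1,2) by (auto simp: cut_def)
    have "d l = tin u \<and> p i \<le> p l"
      using l(2) entries_ordered[of l i] li assms(2,3) by (cases "l = i") (auto simp: good_def pred_def)
    then show ?thesis using l True assms(3) by (auto simp: candidate_def good_def pred_def)
  next
    case False
    have "\<not> pred i" using assms(3) False by (simp add: good_def pred_def)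
    then have il: "i < l" using assms(1,2) by (auto simp: cut_def not_le[symmetric])
    define c where "c = l - 1"
    have c: "c < m" "\<not> pred c" "i \<le> c" using il assms(1) by (auto simp: cut_def c_def)
    have dc: "d c = tin u" "p c \<le> p i" "tin top \<le> p c"
      using c entries_ordered[of i c] assms(3) False by (cases "c = i"; auto simp: good_def pred_def)+
    note ai = anc_desc[OF sorted_edges_less[OF assms(2)]] and ac = anc_desc[OF sorted_edges_less[OF c(1)]]
    have "(anc (sorted_edges ! c), anc (sorted_edges ! i)) \<in> T\<^sup>*"
      using ancestors_of_u_chain[OF _ _ dc(2)] ai(4) ac(4) descI[OF c(1) dc(1)] descI[OF assms(2)] assms(3)
      unfolding good_def by metis
    moreover have "(anc (sorted_edges ! i), bot) \<in> T\<^sup>*"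
      using assms(3) ai(1) vertices by (simp add: good_def ancestor_iff)
    ultimately have "(anc (sorted_edges ! c), bot) \<in> T\<^sup>*" by (rule rtrancl_trans)
    then have "good c" using dc ac(1) vertices by (simp add: good_def ancestor_iff)
    then show ?thesis using False c dc by (simp add: candidate_def c_def)
  qed
  then show "?c < m" "good ?c" "if down then p i \<le> p ?c else p ?c \<le> p i" by simp_all
qed

text \<open>A neighbour that \<open>find\<close> meets before the candidate would come from a good
  entry whose upper end beats it in entry time, contrary to \<open>candidate_best\<close>.\<close>

lemma query_answer_eq:
  assumes "cut l"
  shows "query_answer E u xs =
    (if candidate l < m \<and> good (candidate l) then Some {u, anc (sorted_edges ! candidate l)} else None)"
proof (cases "candidate l < m \<and> good (candidate l)")
  case True
  let ?x = "anc (sorted_edges ! candidate l)"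
  have "find (\<lambda>v. {u, v} \<in> E) (rev xs) = Some ?x"
  proof (rule find_eq_Some[OF path_props(2)])
    show "?x \<in> set (rev xs)" "{u, ?x} \<in> E" using good_path True by auto
    fix w assume w: "w \<in> set (rev xs)" "{u, w} \<in> E"
    then obtain i where i: "i < m" "good i" "anc (sorted_edges ! i) = w" using path_good by auto
    have "w < n" "?x < n" using i anc_desc(1)[OF sorted_edges_less] True by auto
    then show "\<not> (if down then (?x, w) \<in> T\<^sup>+ else (w, ?x) \<in> T\<^sup>+)"
      using candidate_best(3)[OF assms i(1,2)] tin_trancl[of ?x w] tin_trancl[of w ?x] i(3)
      by (auto split: if_splits)
  qed
  then show ?thesis using True by (simp add: query_answer_def)
next
  case False
  have "find (\<lambda>v. {u, v} \<in> E) (rev xs) = None"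
    unfolding find_None_iff
  proof (intro notI, elim exE conjE)
    fix x assume "x \<in> set (rev xs)" "{u, x} \<in> E"
    then obtain i where "i < m" "good i" using path_good by auto
    then show False using candidate_best[OF assms] False by blast
  qed
  then show ?thesis using False by (simp add: query_answer_def)
qed

text \<open>A query involves a vertex off its path and thus at least two vertices. Hence word 0
  exists, from which the radix and \<open>m\<close> are read, and \<open>log 2 n\<close> is at least
  1, which absorbs the constant costs.\<close>

lemma m_pos: "0 < m" and n_ge: "2 \<le> n"
proof -
  have "u \<noteq> top" using u_notin path_props(1) top_bot by auto
  then show "2 \<le> n" using vertices by auto
  then show "0 < m" using n_le by auto
qed

section \<open>Execution of a query\<close>

definition intact :: "(nat \<Rightarrow> nat) \<Rightarrow> bool" where
  "intact M \<longleftrightarrow> (\<forall>i<m. M i = pack b (fields i))"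

lemma length_fields: "length (fields i) = 7"
  by (simp add: fields_def Let_def)

lemma field_exp:
  assumes "intact (mem s)" "reg s 4 = b * b" "reg s 5 = 2 * b" "fits W s a" "val s a < m" "j < 7"
  shows "val s (field_exp a j) = fields (val s a) ! j" and "fits W s (field_exp a j)"
    and "fields (val s a) ! j < W"
proof -
  let ?i = "val s a"
  have w: "mem s ?i = pack b (fields ?i)" "pack b (fields ?i) < W"
    using assms(1,5) structure_words_less by (auto simp: intact_def structure_words_def)
  show v: "val s (field_exp a j) = fields ?i ! j"
    using unpack[OF b_bounds(3) fields_less[OF assms(5)]] assms(6) length_fields
    by (simp add: field_exp_def val_shift_exp w assms(2,3))
  show "fields ?i ! j < W"
    using fields_less[OF assms(5)] assms(6) length_fields radix_less(3) by (metis less_trans nth_mem)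
  then have "val s (field_exp a j) < W" by (simp only: v)
  moreover have "b * b \<ge> 2" using W_bounds(4) n_ge by simp
  then have "(b * b) ^ j < (b * b) ^ 7" using assms(6) by (intro power_strict_increasing) auto
  then have "2 * b * (b * b) ^ j < W"
    using W_bounds(2) b_bounds(3) by (meson less_le_trans mult_less_mono2 nat_0_less_mult_iff zero_less_numeral)
  moreover from this have "fits W s (shift_exp j)"
    using b_bounds(3) radix_less(3) by (intro fits_shift_exp) (simp_all add: assms(2,3))
  moreover have "pack b (fields ?i) div (2 * b * (b * b) ^ j) < W"
    using w(2) by (meson div_le_dividend le_less_trans)
  ultimately show "fits W s (field_exp a j)"
    using assms(4) w radix_less(3) by (simp add: field_exp_def val_shift_exp assms(2,3))
qed

lemma fields_nth:
  "fields i ! 0 = d i" "fields i ! Suc 0 = p i" "fields i ! 2 = q i" "fields i ! 3 = anc (sorted_edges ! i)"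
  "fields i ! 4 = tin (Suc i mod n)" "fields i ! 5 = tin 0" "fields i ! 6 = m"
  by (simp_all add: fields_def Let_def)

lemma field_val:
  assumes "intact (mem s)" "reg s 4 = b * b" "reg s 5 = 2 * b" "fits W s a" "val s a < m"
  shows "val s (field_exp a 0) = d (val s a)" "val s (field_exp a (Suc 0)) = p (val s a)"
    "val s (field_exp a 2) = q (val s a)" "val s (field_exp a 3) = anc (sorted_edges ! val s a)"
    "val s (field_exp a 4) = tin (Suc (val s a) mod n)" "val s (field_exp a 5) = tin 0"
    "val s (field_exp a 6) = m"
  using field_exp(1)[OF assms] by (simp_all add: fields_nth)

lemmas field_exp_simps = field_val field_exp(2)

lemma word_bounds: "n < W" "m < W" "3 < W" "clock (v, f) < W" if "v < n" for v f
  using layout clock(1)[OF that, of f] by linarith+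

lemma runs_find_radix:
  assumes "intact M" "mem s = M" "reg s 3 = 1" "reg s 0 = u" "reg s 1 = ps" "reg s 2 = pe"
  shows "runs W find_radix (J * 20 + 20)
    (\<lambda>s. reg s 3 = b \<and> mem s = M \<and> reg s 0 = u \<and> reg s 1 = ps \<and> reg s 2 = pe) s"
proof -
  define R where "R i s \<longleftrightarrow> reg s 3 = 2 ^ i \<and> mem s = M \<and> reg s 0 = u \<and> reg s 1 = ps \<and> reg s 2 = pe" for i and s :: state
  let ?b = "Bin Mod (Load (Const 0)) (Const 2 \<otimes> Reg 3) \<doteq> Const 0"
  let ?p = "Assign 3 (Const 2 \<otimes> Reg 3)"
  have w: "M 0 = pack b (fields 0)" "M 0 < W"
    using assms(1) m_pos structure_words_less by (auto simp: intact_def structure_words_def)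
  \<comment> \<open>By the form of \<open>pack\<close>, word 0 is \<open>2 ^ J\<close> times an odd
    number, so doubling as long as the doubled value divides it stops exactly at
    \<open>b\<close>.\<close>
  obtain h where h: "M 0 = 2 ^ J * (1 + 2 * h)"
    using w(1) by (auto simp: pack_def b_def algebra_simps)
  have md: "M 0 mod (2 * 2 ^ i) = 0 \<longleftrightarrow> i < J" if "i \<le> J" for i
  proof (cases "i = J")
    case True
    have "M 0 mod (2 ^ J * 2) = 2 ^ J * ((1 + 2 * h) mod 2)" unfolding h by (rule mod_mult_mult1)
    moreover have "(1 + 2 * h) mod 2 = 1" by presburger
    ultimately show ?thesis using True by (simp add: mult.commute)
  next
    case False
    then have "(2::nat) ^ Suc i dvd 2 ^ J" using that by (intro le_imp_power_dvd) simp
    then have "2 * 2 ^ i dvd M 0" unfolding h by (simp add: dvd_mult2)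
    then show ?thesis using False that by simp
  qed
  have le: "(2::nat) ^ i \<le> b" if "i \<le> J" for i using that by (simp add: b_def)
  have "runs W (While ?b ?p) (J * (cost ?b + 1 + max_time ?p) + cost ?b + 1) (R J) s"
  proof (rule runs_for[where J = R])
    show "R 0 s" using assms by (simp add: R_def)
  next
    fix i s assume R: "R i s" "i \<le> J"
    have "2 * 2 ^ i < W" "(2::nat) ^ i < W" using le[OF R(2)] radix_less by linarith+
    moreover have "M 0 mod (2 * 2 ^ i) < W" using w(2) by (meson le_less_trans mod_less_eq_dividend)
    ultimately show "fits W s ?b \<and> (val s ?b \<noteq> 0) = (i < J)"
      using R md[OF R(2)] w(2) word_bounds(1-3)[OF vertices(1)] by (auto simp: R_def)
  next
    fix i s assume R: "R i s" "i < J"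
    then have "2 * 2 ^ i < W" "(2::nat) ^ i < W" using le[of i] radix_less by linarith+
    then show "wp W ?p (R (Suc i)) s" using R word_bounds(1-3)[OF vertices(1)] by (simp add: R_def)
  qed
  then show ?thesis unfolding find_radix_def
    by (rule runs_weaken) (auto simp: R_def b_def)
qed

lemma wp_read_clock:
  assumes "v < n" "reg s i = v" "intact (mem s)" "reg s 4 = b * b" "reg s 5 = 2 * b"
    and "Q (s\<lparr>reg := (reg s)(j := tin v)\<rparr>)"
  shows "wp W (read_clock i j) Q s"
proof (cases v)
  case 0
  then show ?thesis
    using assms m_pos word_bounds(1-3)[OF assms(1)] word_bounds(4)[OF assms(1), of False] by (simp add: read_clock_def field_exp_simps)
next
  case (Suc v')
  \<comment> \<open>The word \<open>v - 1\<close> exists because \<open>v < n \<le> m + 1\<close>,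
    and the reduction modulo \<open>n\<close> does not affect an index below
    \<open>n\<close>.\<close>
  then have "v' < m" "Suc v' mod n = v" using assms(1) n_le by auto
  then show ?thesis
    using assms Suc word_bounds(1-3)[OF assms(1)] word_bounds(4)[OF assms(1), of False] by (simp add: read_clock_def field_exp_simps)
qed

definition searching :: "(nat \<Rightarrow> nat) \<Rightarrow> state \<Rightarrow> bool" where
  "searching M s \<longleftrightarrow> mem s = M \<and> reg s 0 = u \<and> reg s 4 = b * b \<and> reg s 5 = 2 * b \<and> reg s 6 = tin u \<and>
     reg s 9 = (if down then 1 else 0) \<and> reg s 10 = tin top \<and> reg s 11 = tin bot"

lemma runs_read_clocks:
  assumes "intact M" "reg s 3 = b" "mem s = M" "reg s 0 = u" "reg s 1 = ps" "reg s 2 = pe"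
  shows "runs W read_clocks 1000 (\<lambda>s. searching M s \<and> reg s 12 = 0 \<and> reg s 13 = m) s"
proof -
  have cl: "tin u < W" "tin ps < W" "tin pe < W" using word_bounds(4) vertices by auto
  let ?s = "s\<lparr>reg := (reg s)(4 := b * b, 5 := 2 * b)\<rparr>"
  let ?s' = "s\<lparr>reg := (reg s)(4 := b * b, 5 := 2 * b, 6 := tin u, 7 := tin ps, 8 := tin pe)\<rparr>"
  let ?r = "Assign 9 (Reg 7 \<prec> Reg 8) ;;
     Cond (Reg 9) (Assign 10 (Reg 7) ;; Assign 11 (Reg 8)) (Assign 10 (Reg 8) ;; Assign 11 (Reg 7)) ;;
     Assign 12 (Const 0) ;; Assign 13 (field_exp (Const 0) 6)"
  let ?Q = "\<lambda>s. searching M s \<and> reg s 12 = 0 \<and> reg s 13 = m"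
  have r: "wp W ?r ?Q ?s'"
    using assms cl m_pos word_bounds(1-3)[OF vertices(1)] by (auto simp: searching_def down_def top_def bot_def field_exp_simps)
  have r2: "wp W (read_clock 2 8) (wp W ?r ?Q) (?s\<lparr>reg := (reg ?s)(6 := tin u, 7 := tin ps)\<rparr>)"
    by (rule wp_read_clock[OF vertices(3)]) (use assms r in \<open>simp_all del: wp.simps\<close>)
  have r1: "wp W (read_clock 1 7) (wp W (read_clock 2 8) (wp W ?r ?Q)) (?s\<lparr>reg := (reg ?s)(6 := tin u)\<rparr>)"
    by (rule wp_read_clock[OF vertices(2)]) (use assms r2 in \<open>simp_all del: wp.simps\<close>)
  have "wp W (read_clock 0 6) (wp W (read_clock 1 7) (wp W (read_clock 2 8) (wp W ?r ?Q))) ?s"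
    by (rule wp_read_clock[OF vertices(1)]) (use assms r1 in \<open>simp_all del: wp.simps\<close>)
  then have "wp W (read_clock 0 6 ;; read_clock 1 7 ;; read_clock 2 8 ;; ?r) ?Q ?s"
    by (simp only: wp_Seq)
  then have "wp W read_clocks ?Q s"
    unfolding read_clocks_def wp_Seq wp.simps(2)[of W 4] wp.simps(2)[of W 5]
    using assms radix_less word_bounds(1-3)[OF vertices(1)] by (simp del: wp.simps)
  then show ?thesis
    by (rule runs_weaken[OF wp_runs]) (simp_all add: read_clocks_def read_clock_def cost_field_exp)
qed

text \<open>\<open>k\<close> is the potential for \<open>runs_While\<close>: halving the interval
  lowers it by one. It starts at \<open>2 * J\<close>, because
  \<open>m < b * b = 2 ^ (2 * J)\<close>; this makes a search over the edges logarithmic in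
  \<open>n\<close>.\<close>

definition inv_search :: "(nat \<Rightarrow> nat) \<Rightarrow> nat \<Rightarrow> state \<Rightarrow> bool" where
  "inv_search M k s \<longleftrightarrow> searching M s \<and> reg s 12 \<le> reg s 13 \<and> reg s 13 \<le> m \<and> reg s 13 - reg s 12 < 2 ^ k \<and>
     (\<forall>i<reg s 12. \<not> pred i) \<and> (\<forall>i\<ge>reg s 13. i < m \<longrightarrow> pred i)"

lemma runs_search:
  assumes "intact M" "searching M s" "reg s 12 = 0" "reg s 13 = m"
  shows "runs W search (2 * J * 400 + 20) (\<lambda>s. searching M s \<and> cut (reg s 12)) s"
proof -
  let ?b = "Reg 12 \<prec> Reg 13"
  let ?q = "Assign 14 (Bin Div (Reg 12 \<oplus> Reg 13) (Const 2)) ;;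
      Assign 15 (field_exp (Reg 14) 0) ;; Assign 16 (field_exp (Reg 14) 1) ;; Assign 17 (field_exp (Reg 14) 2)"
  let ?r1 = "Cond (Reg 9) (Assign 18 (Const 1 \<ominus> ((Reg 11 \<prec> Reg 16) \<oplus> (Reg 17 \<prec> Reg 11)))) (Assign 18 (Reg 16 \<prec> Reg 10))"
  let ?r2 = "Cond ((Reg 6 \<prec> Reg 15) \<oplus> (Reg 6 \<doteq> Reg 15) \<otimes> Reg 18) (Assign 13 (Reg 14)) (Assign 12 (Reg 14 \<oplus> Const 1))"
  let ?r = "Cond (Reg 9) (Assign 18 (Const 1 \<ominus> ((Reg 11 \<prec> Reg 16) \<oplus> (Reg 17 \<prec> Reg 11)))) (Assign 18 (Reg 16 \<prec> Reg 10)) ;;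
      Cond ((Reg 6 \<prec> Reg 15) \<oplus> (Reg 6 \<doteq> Reg 15) \<otimes> Reg 18) (Assign 13 (Reg 14)) (Assign 12 (Reg 14 \<oplus> Const 1))"
  let ?p = "Assign 14 (Bin Div (Reg 12 \<oplus> Reg 13) (Const 2)) ;;
      Assign 15 (field_exp (Reg 14) 0) ;; Assign 16 (field_exp (Reg 14) 1) ;; Assign 17 (field_exp (Reg 14) 2) ;; ?r"
  note sm = word_bounds(1-3)[OF vertices(1)]
  have "runs W (While ?b ?p) (2 * J * (cost ?b + 1 + max_time ?p) + cost ?b + 1)
     (\<lambda>s. (\<exists>k. inv_search M k s) \<and> val s ?b = 0) s"
  proof (rule runs_While)
    have "m < 2 ^ (2 * J)" using W_bounds(3) by (simp add: b_def mult_2 power_add)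
    then show "inv_search M (2 * J) s" using assms by (auto simp: inv_search_def)
  next
    fix k s assume "inv_search M k s"
    then show "fits W s ?b" using sm(1-3) by (auto simp: inv_search_def)
  next
    fix k s assume I: "inv_search M k s" and v: "val s ?b \<noteq> 0"
    define l h where "l = reg s 12" and "h = reg s 13"
    have S: "searching M s" "l < h" "h \<le> m" "h - l < 2 ^ k" "\<forall>i<l. \<not> pred i" "\<forall>i\<ge>h. i < m \<longrightarrow> pred i"
      using I v by (auto simp: inv_search_def l_def h_def split: if_splits)
    then obtain k' where k: "k = Suc k'" by (cases k) auto
    define c where "c = (l + h) div 2"
    have c: "l \<le> c" "c < h" "c < m" "c - l < 2 ^ k'" "h - Suc c < 2 ^ k'"
      using S(2-4) by (auto simp: c_def k)
    have regs: "reg s 12 = l" "reg s 13 = h" "mem s = M" "reg s 4 = b * b" "reg s 5 = 2 * b"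
      using S(1) by (simp_all add: l_def h_def searching_def)
    have lh: "l + h < W" "l < W" "h < W" "c < W" using S(2,3) c layout by linarith+
    define R where "R s' \<longleftrightarrow> searching M s' \<and> reg s' 12 = l \<and> reg s' 13 = h \<and> reg s' 14 = c \<and>
      reg s' 15 = d c \<and> reg s' 16 = p c \<and> reg s' 17 = q c" for s'
    have "wp W ?q R s"
      using regs lh c(3) assms(1) sm(1-3) S(1) c_def[symmetric]
      by (simp add: field_exp_simps R_def searching_def)
    then have "wp W ?q (wp W ?r (\<lambda>s'. \<exists>k'<k. inv_search M k' s')) s"
    proof (rule wp_mono)
      fix s' assume R: "R s'"
      have an: "anc (sorted_edges ! c) < n" "desc (sorted_edges ! c) < n" using anc_desc[OF sorted_edges_less[OF c(3)]] by auto
      have cl: "d c < W" "p c < W" "q c < W" "tin u < W" "tin top < W" "tin bot < W"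
        by (intro word_bounds(4) vertices an)+
      have lower: "inv_search M k' (s'\<lparr>reg := (reg s')(18 := x, 13 := c)\<rparr>)" if "pred c" for x
      proof -
        have "pred i" if "c \<le> i" "i < m" for i using pred_mono[of c i] \<open>pred c\<close> that by (cases "i = c") auto
        then show ?thesis using R c S by (simp add: R_def inv_search_def searching_def)
      qed
      have upper: "inv_search M k' (s'\<lparr>reg := (reg s')(18 := x, 12 := Suc c)\<rparr>)" if "\<not> pred c" for x
      proof -
        have "\<not> pred i" if "i < Suc c" for i using pred_mono[of i c] \<open>\<not> pred c\<close> that c(3) by (cases "i = c") auto
        then show ?thesis using R c S by (simp add: R_def inv_search_def searching_def)
      qed
      have kk: "k' < k" by (simp add: k)
      have regs': "reg s' 6 = tin u" "reg s' 9 = (if down then 1 else 0)" "reg s' 10 = tin top" "reg s' 11 = tin bot"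
        "reg s' 14 = c" "reg s' 15 = d c" "reg s' 16 = p c" "reg s' 17 = q c"
        using R by (simp_all add: R_def searching_def)
      define x where "x = (if down then 1 - ((if tin bot < p c then 1 else 0) + (if q c < tin bot then 1 else 0))
        else if p c < tin top then 1 else (0::nat))"
      have pred_iff: "pred c \<longleftrightarrow> tin u < d c \<or> tin u = d c \<and> x \<noteq> 0" by (auto simp: pred_def x_def)
      have x: "x \<le> 1" by (simp add: x_def)
      have "wp W ?r1 (\<lambda>t. t = s'\<lparr>reg := (reg s')(18 := x)\<rparr>) s'"
        using regs' cl sm(1-3) by (cases down) (simp_all add: x_def)
      then have "wp W ?r1 (wp W ?r2 (\<lambda>s'. \<exists>k'<k. inv_search M k' s')) s'"
      proof (rule wp_mono)
        fix t assume t: "t = s'\<lparr>reg := (reg s')(18 := x)\<rparr>"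
        show "wp W ?r2 (\<lambda>s'. \<exists>k'<k. inv_search M k' s') t"
        proof (cases "pred c")
          case True
          have "\<exists>k''<k. inv_search M k'' (s'\<lparr>reg := (reg s')(18 := x, 13 := c)\<rparr>)"
            by (intro exI[of _ k'] conjI kk lower[OF True])
          moreover have "tin u < d c \<or> tin u = d c \<and> x = 1" using True x unfolding pred_iff by linarith
          moreover have "x < W" using x sm(3) by linarith
          ultimately show ?thesis using regs' cl lh(4) sm(1-3) by (cases "tin u < d c") (simp_all add: t)
        next
          case False
          have "\<exists>k''<k. inv_search M k'' (s'\<lparr>reg := (reg s')(18 := x, 12 := Suc c)\<rparr>)"
            by (intro exI[of _ k'] conjI kk upper[OF False])
          moreover have "\<not> tin u < d c" "tin u \<noteq> d c \<or> x = 0" using False unfolding pred_iff by simp_all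
          moreover have "x < W" "Suc c < W" using x c(3) sm(2,3) by linarith+
          ultimately show ?thesis using regs' cl lh(4) sm(1-3)
            by (cases "tin u = d c") (simp_all add: t)
        qed
      qed
      then show "wp W ?r (\<lambda>s'. \<exists>k'<k. inv_search M k' s') s'" by (simp only: wp_Seq)
    qed
    then show "wp W ?p (\<lambda>s'. \<exists>k'<k. inv_search M k' s') s" by (simp only: wp_Seq)
  qed
  then show ?thesis unfolding search_def
  proof (rule runs_weaken)
    fix s assume "(\<exists>k. inv_search M k s) \<and> val s ?b = 0"
    then obtain k where "inv_search M k s" "\<not> reg s 12 < reg s 13" by (auto split: if_splits)
    then show "searching M s \<and> cut (reg s 12)" by (auto simp: inv_search_def cut_def)
  qed (simp add: cost_field_exp)
qed

lemma runs_finish: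
  assumes "intact M" "searching M s" "cut (reg s 12)"
  shows "runs W finish 1000 (\<lambda>s. mem s = M \<and> query_output s = query_answer E u xs) s"
proof -
  define l where "l = reg s 12"
  define c where "c = candidate l"
  note sm = word_bounds(1-3)[OF vertices(1)]
  have l: "l \<le> m" using assms(3) by (simp add: cut_def l_def)
  let ?q = "Cond (Reg 9) Skip (Assign 12 (Reg 12 \<ominus> Const 1))"
  let ?r = "Cond (Reg 12 \<prec> field_exp (Const 0) 6)
       (Assign 15 (field_exp (Reg 12) 0) ;; Assign 16 (field_exp (Reg 12) 1) ;; Assign 17 (field_exp (Reg 12) 2) ;;
        Assign 1 (Reg 0) ;; Assign 2 (field_exp (Reg 12) 3) ;;
        Assign 0 ((Reg 15 \<doteq> Reg 6) \<otimes> (Const 1 \<ominus> (Reg 16 \<prec> Reg 10)) \<otimes>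
          (Const 1 \<ominus> (Reg 11 \<prec> Reg 16)) \<otimes> (Const 1 \<ominus> (Reg 17 \<prec> Reg 11))))
       (Assign 0 (Const 0))"
  let ?Q = "\<lambda>s. mem s = M \<and> query_output s = query_answer E u xs"
  have "wp W ?q (\<lambda>s. searching M s \<and> reg s 12 = c) s"
    using assms(2) l sm(1-3) l_def[symmetric] by (cases down) (simp_all add: searching_def c_def candidate_def)
  then have "wp W ?q (wp W ?r ?Q) s"
  proof (rule wp_mono)
    fix s assume s: "searching M s \<and> reg s 12 = c"
    have c: "c \<le> m" using l by (cases down) (simp_all add: c_def candidate_def)
    show "wp W ?r ?Q s"
    proof (cases "c < m")
      case True
      have an: "anc (sorted_edges ! c) < n" "desc (sorted_edges ! c) < n" using anc_desc[OF sorted_edges_less[OF True]] by auto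
      have cl: "d c < W" "p c < W" "q c < W" "tin u < W" "tin top < W" "tin bot < W" "anc (sorted_edges ! c) < W"
        by (intro word_bounds(4) vertices an less_trans[OF an(1) sm(1)])+
      have ans: "query_answer E u xs = (if good c then Some {u, anc (sorted_edges ! c)} else None)"
        using query_answer_eq[OF assms(3)] True by (simp add: c_def l_def)
      show ?thesis
        using s True assms(1) m_pos sm(1-3) cl vertices(1) unfolding ans
        by (simp add: field_exp_simps searching_def query_output_def good_def)
    next
      case False
      then have "query_answer E u xs = None" using query_answer_eq[OF assms(3)] by (simp add: c_def l_def)
      then show ?thesis
        using s False assms(1) m_pos sm(1-3) c by (simp add: field_exp_simps searching_def query_output_def)
    qed
  qed
  then have "wp W finish ?Q s" unfolding finish_def by (simp only: wp_Seq)
  then show ?thesis by (rule runs_weaken[OF wp_runs]) (simp_all add: finish_def cost_field_exp)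
qed

lemma query_correct:
  assumes "holds structure_words M"
  shows "\<exists>t s. exec W query_program (query_input M u ps pe) t s \<and> t \<le> 820 * J + 2100 \<and>
    mem s = M \<and> query_output s = query_answer E u xs"
proof -
  have M: "intact M" using assms by (simp add: intact_def holds_def structure_words_def)
  let ?s = "query_input M u ps pe"
  let ?A = "\<lambda>s. mem s = M \<and> reg s 3 = 1 \<and> reg s 0 = u \<and> reg s 1 = ps \<and> reg s 2 = pe"
  have "wp W (Assign 3 (Const 1)) ?A ?s"
    using word_bounds(1-3)[OF vertices(1)] by (simp add: query_input_def words_def)
  then have 1: "runs W (Assign 3 (Const 1)) 2 ?A ?s" by (rule runs_weaken[OF wp_runs]) simp_all
  have 2: "runs W find_radix (J * 20 + 20)
    (\<lambda>s. reg s 3 = b \<and> mem s = M \<and> reg s 0 = u \<and> reg s 1 = ps \<and> reg s 2 = pe) s" if "?A s" for s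
    using runs_find_radix[OF M] that by blast
  have 3: "runs W read_clocks 1000 (\<lambda>s. searching M s \<and> reg s 12 = 0 \<and> reg s 13 = m) s"
    if "reg s 3 = b \<and> mem s = M \<and> reg s 0 = u \<and> reg s 1 = ps \<and> reg s 2 = pe" for s
    using runs_read_clocks[OF M] that by blast
  have 4: "runs W search (2 * J * 400 + 20) (\<lambda>s. searching M s \<and> cut (reg s 12)) s"
    if "searching M s \<and> reg s 12 = 0 \<and> reg s 13 = m" for s
    using runs_search[OF M] that by blast
  have 5: "runs W finish 1000 (\<lambda>s. mem s = M \<and> query_output s = query_answer E u xs) s"
    if "searching M s \<and> cut (reg s 12)" for s
    using runs_finish[OF M] that by blast
  have "runs W query_program (820 * J + 2100) (\<lambda>s. mem s = M \<and> query_output s = query_answer E u xs) ?s"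
    unfolding query_program_def
    by (rule runs_weaken[OF runs_Seq[OF 1 runs_Seq[OF 2 runs_Seq[OF 3 runs_Seq[OF 4 5]]]]]) simp_all
  then show ?thesis unfolding runs_def by blast
qed

text \<open>From \<open>2 ^ J = b \<le> 2 * n\<close> one gets \<open>J \<le> 1 + log 2 n\<close>,
  and the summand 1 is itself at most \<open>log 2 n\<close>.\<close>

lemma J_le_log: "real J \<le> 2 * log 2 (real n)" "1 \<le> log 2 (real n)"
proof -
  have "log 2 2 \<le> log 2 (real n)" using n_ge by (intro log_mono) auto
  then show 1: "1 \<le> log 2 (real n)" by simp
  have "2 ^ J \<le> 2 * real n" using b_bounds(2) unfolding b_def
    by (metis of_nat_le_iff of_nat_mult of_nat_numeral of_nat_power)
  then have "log 2 (2 ^ J) \<le> log 2 (2 * real n)" using n_ge by (intro log_mono) auto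
  also have "\<dots> = 1 + log 2 (real n)" using n_ge by (simp add: log_mult)
  finally show "real J \<le> 2 * log 2 (real n)" using 1 by (simp add: log_nat_power)
qed

lemma answers_query: "answers W query_program structure_words u ps pe (5000 * log 2 (real n)) (query_answer E u xs)"
  unfolding answers_def
proof (intro allI impI)
  fix M assume M: "holds structure_words M"
  obtain t s where ts: "exec W query_program (query_input M u ps pe) t s" "t \<le> 820 * J + 2100"
    "mem s = M" "query_output s = query_answer E u xs"
    using query_correct[OF M] by blast
  have "real t \<le> 820 * real J + 2100"
    using ts(2) by (metis of_nat_add of_nat_le_iff of_nat_mult of_nat_numeral)
  \<comment> \<open>The two bounds of \<open>J_le_log\<close> give at most
    \<open>(2 * 820 + 2100) * log 2 n\<close>, that is, 3740 times the logarithm.\<close>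
  also have "\<dots> \<le> 5000 * log 2 (real n)" using J_le_log by simp
  finally show "\<exists>t s. exec W query_program (query_input M u ps pe) t s \<and> real t \<le> 5000 * log 2 (real n) \<and>
      holds structure_words (mem s) \<and> query_output s = query_answer E u xs"
    using ts M by blast
qed

end

theorem theorem3:
  "\<exists>(build :: com) (query :: com) (k :: nat) (c :: real).
     \<forall>(n :: nat) (m :: nat) (E :: nat set set) (r :: nat) (T :: (nat \<times> nat) set)
       (es :: (nat \<times> nat) list) (par :: nat list).
       ugraph {..<n} E \<and> card E = m \<and> dfs_tree {..<n} E r T \<and> represents n E r T es par \<longrightarrow>
       (\<exists>D :: nat list.
          length D = m \<and> (\<forall>w\<in>set D. w < (n + 1) ^ k) \<and>
          builds ((n + 1) ^ k) build n es par (c * (real m + real n)) D \<and>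
          (\<forall>u ps pe xs. is_query {..<n} T r u ps pe xs \<longrightarrow>
             answers ((n + 1) ^ k) query D u ps pe (c * log 2 (real n)) (query_answer E u xs)))"
proof (rule exI[of _ build_program], rule exI[of _ query_program], rule exI[of _ 40], rule exI[of _ 5000],
    intro allI impI, elim conjE)
  fix n m E r T es par
  assume "ugraph {..<n} E" "card E = m" "dfs_tree {..<n} E r T" "represents n E r T es par"
  then interpret dfs_run n m E r T es par "(n + 1) ^ 40" by unfold_locales (assumption | rule refl)+
  obtain t s where ts: "exec ((n + 1) ^ 40) build_program (build_input n es par) t s" "t \<le> 5000 * (n + m)"
    "holds structure_words (mem s)"
    using build_correct by blast
  have "real t \<le> 5000 * (real m + real n)"
    using ts(2) by (metis add.commute of_nat_add of_nat_le_iff of_nat_mult of_nat_numeral)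
  then have "builds ((n + 1) ^ 40) build_program n es par (5000 * (real m + real n)) structure_words"
    unfolding builds_def using ts by blast
  moreover have "answers ((n + 1) ^ 40) query_program structure_words u ps pe (5000 * log 2 (real n)) (query_answer E u xs)"
    if "is_query {..<n} T r u ps pe xs" for u ps pe xs
  proof -
    interpret dfs_query n m E r T es par "(n + 1) ^ 40" u ps pe xs by unfold_locales (rule that)
    show ?thesis by (rule answers_query)
  qed
  moreover have "length structure_words = m" by (simp add: structure_words_def)
  ultimately show "\<exists>D. length D = m \<and> (\<forall>w\<in>set D. w < (n + 1) ^ 40) \<and>
      builds ((n + 1) ^ 40) build_program n es par (5000 * (real m + real n)) D \<and>
      (\<forall>u ps pe xs. is_query {..<n} T r u ps pe xs \<longrightarrow>
         answers ((n + 1) ^ 40) query_program D u ps pe (5000 * log 2 (real n)) (query_answer E u xs))"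
    using structure_words_less by blast
qed

end
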